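(* Let $r\in\mathbb{N}_0$ and $m\in\mathbb{N}$ with $m\ge r+1$, and let $X=\{x_j\}_{j=0}^m$ be real numbers with $x_0\le x_1\le\dots\le x_m$ such that $x_j<x_{j+r+1}$ for all $0\le j\le m-r-1$. If $f\in C^{(r)}[x_0,x_m]$, then \[ \big|[x_0,\dots,x_m;f]\big|\le c\,\Lambda_r(x_0,\dots,x_m;\omega_k), \] where $k:=m-r$, $\omega_k(t):=\omega_k(f^{(r)},t;[x_0,x_m])$, and the constant $c$ depends only on $m$.
   Context: Modulus of smoothness: for $g\in C[a,b]$, $k\in\mathbb{N}$, set $\Delta^k_u(g,x;[a,b]):=\sum_{i=0}^k(-1)^i\binom ki g(x+(k/2-i)u)$ if $x\pm(k/2)u\in[a,b]$ and $:=0$ otherwise, and $\omega_k(g,t;[a,b]):=\sup_{0<u\le t}\|\Delta^k_u(g,\cdot;[a,b])\|_{C[a,b]}$. Divided differences (Lagrange–Hermite) for points $x_0\le\dots\le x_m$ with possible repetitions: $[x_0;f]:=f(x_0)$; if $x_0=\dots=x_m$, $[x_0,\dots,x_m;f]:=f^{(m)}(x_0)/m!$; otherwise pick $j^*$ with $x_{j^*}\neq x_0$ and set $[x_0,\dots,x_m;f]:=\frac{[x_1,\dots,x_m;f]-[x_0,\dots,x_{j^*-1},x_{j^*+1},\dots,x_m;f]}{x_{j^*}-x_0}$ (this is symmetric in the points and well defined). For an ordered tuple $y_0\le\dots\le y_n$ (with $n\ge r+1$), put $\mathcal{Q}_{n,r}:=\{(p,q):0\le p,q\le n,\ q-p\ge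 r+1\}$, $y_{-1}:=y_0-(y_n-y_0)$, $y_{n+1}:=y_n+(y_n-y_0)$, $d(p,q):=\min\{y_{q+1}-y_p,\,y_q-y_{p-1}\}$, and for a nondecreasing $\varphi\in C[0,\infty]$ with $\varphi(0)=0$, \[ \Lambda_{p,q,r}(y_0,\dots,y_n;\varphi):=\frac{\int_{y_q-y_p}^{d(p,q)}u^{p+r-q-1}\varphi(u)\,du}{\prod_{i=0}^{p-1}(y_q-y_i)\prod_{i=q+1}^{n}(y_i-y_p)},\qquad \Lambda_r(y_0,\dots,y_n;\varphi):=\max_{(p,q)\in\mathcal{Q}_{n,r}}\Lambda_{p,q,r}(y_0,\dots,y_n;\varphi), \] with empty products equal to $1$. *)

theory Defs
  imports "HOL-Analysis.Analysis"
begin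

definition sym_diff :: "nat \<Rightarrow> (real \<Rightarrow> real) \<Rightarrow> real \<Rightarrow> real \<Rightarrow> real \<Rightarrow> real \<Rightarrow> real" where
  "sym_diff k g u a b x =
     (if a \<le> x - (real k / 2) * u \<and> x + (real k / 2) * u \<le> b
      then (\<Sum>i\<le>k. (-1) ^ i * real (k choose i) * g (x + (real k / 2 - real i) * u))
      else 0)"

definition modsmooth :: "nat \<Rightarrow> (real \<Rightarrow> real) \<Rightarrow> real \<Rightarrow> real \<Rightarrow> real \<Rightarrow> real" where
  "modsmooth k g a b t = (SUP u\<in>{0<..t}. (SUP x\<in>{a..b}. \<bar>sym_diff k g u a b x\<bar>))"

text \<open>C^r on [a,b]: D 0 = f, D i is continuous on [a,b] for i<=r and D (i+1) is the
  (one-sided at endpoints) derivative of D i on [a,b] for i<r.\<close>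
definition Cr_on :: "nat \<Rightarrow> (nat \<Rightarrow> real \<Rightarrow> real) \<Rightarrow> real \<Rightarrow> real \<Rightarrow> bool" where
  "Cr_on r D a b \<longleftrightarrow>
     (\<forall>i\<le>r. continuous_on {a..b} (D i)) \<and>
     (\<forall>i<r. \<forall>x\<in>{a..b}. (D i has_real_derivative D (Suc i) x) (at x within {a..b}))"

text \<open>Lagrange--Hermite divided difference of f = D 0, with D i standing for f^(i).
  In the non-coalescent case the removed point x_{j*} is the last point.\<close>
function divdiff :: "(nat \<Rightarrow> real \<Rightarrow> real) \<Rightarrow> real list \<Rightarrow> real" where
  "divdiff D [] = 0"
| "divdiff D [x] = D 0 x"
| "divdiff D (x # y # zs) =
     (if (\<forall>z\<in>set (x # y # zs). z = x)
      then D (Suc (length zs)) x / fact (Suc (length zs))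
      else (divdiff D (y # zs) - divdiff D (butlast (x # y # zs))) / (last (x # y # zs) - x))"
  by pat_completeness auto
termination
  by (relation "Wellfounded.measure (\<lambda>(D, xs). length xs)") auto

text \<open>Lambda_{p,q,r}(y_0,...,y_n; phi), with y_{-1} = y_0-(y_n-y_0), y_{n+1} = y_n+(y_n-y_0).\<close>
definition Lambda_pq :: "nat \<Rightarrow> nat \<Rightarrow> nat \<Rightarrow> nat \<Rightarrow> (nat \<Rightarrow> real) \<Rightarrow> (real \<Rightarrow> real) \<Rightarrow> real" where
  "Lambda_pq p q r n y \<phi> =
     (let yup = (if q = n then y n + (y n - y 0) else y (Suc q));
          ydown = (if p = 0 then y 0 - (y n - y 0) else y (p - 1));
          d = min (yup - y p) (y q - ydown)
      in integral {y q - y p..d} (\<lambda>u. u powi (int p + int r - int q - 1) * \<phi> u)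
         / ((\<Prod>i<p. y q - y i) * (\<Prod>i\<in>{Suc q..n}. y i - y p)))"

definition Lambda :: "nat \<Rightarrow> nat \<Rightarrow> (nat \<Rightarrow> real) \<Rightarrow> (real \<Rightarrow> real) \<Rightarrow> real" where
  "Lambda r n y \<phi> =
     Max {Lambda_pq p q r n y \<phi> | p q. p \<le> n \<and> q \<le> n \<and> p + r + 1 \<le> q}"

end

(* By Whitney's inequality, every interval [a, b] inside [x_0, x_m] carries a polynomial Q of degree < m with
   |f^(r) - Q^(r)| <= C omega_k(b - a) on [a, b].  Apply the recursion of divided differences to f - Q_{p,q},
   where Q_{p,q} belongs to [x_p, x_q]: in each of the two shorter divided differences replace Q_{p,q} by the
   polynomial of the shorter interval.  The correction is a divided difference of a polynomial, i.e. one of its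
   derivatives, and a Markov inequality on a dyadic chain of intervals bounds it by the integral of
   u^(p+r-q-1) omega_k(u) over the scales between the two lengths.  At a scale u at which x_p, ..., x_q is not a
   maximal cluster one passes to a larger cluster, so all these integrals are dominated by Lambda_r.  The recursion
   stops at q - p = r, where the mean value theorem applies, and starts at (0, m), where Q contributes nothing. *)
theory Submission
  imports Defs
begin

subsection \<open>Finite differences and Whitney's inequality\<close>

text \<open>\<open>Lambda_r\<close> controls integrals only over [x_q - x_p, d(p,q)] and only for q
  - p > r, whereas the recursion needs them up to the length of a parent interval, needs single
  values of omega_k, and ends in clusters of r + 1 nodes that may coincide. The weight
  \<open>wt\<close>, the denominator truncated at a scale u, bridges this. The invariant is:
  remainder at most const * \<open>L\<close> * \<open>W p q (x q - x p)\<close>. Dropping an end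
  node of an interval of length h multiplies the weight by at most h, which the division by h in the
  recursion cancels; enlarging a cluster at scale u lowers the weight by a factor u up to a
  constant, which matches the change of exponent in the kernel. At the top the weight is 1 and
  \<open>L\<close> itself remains. Single values omega_k(u) come from integrals over [u, 2u] by
  monotonicity. For u > H/2, H = x_m - x_0, the range [H, 2H] of the full cluster takes over, which
  exists thanks to the artificial nodes y_{-1} and y_{n+1}. All constants must be uniform in
  interval, function and nodes; Whitney's inequality therefore gets an explicit constant, through
  Steklov means.\<close>

primrec fdiff :: "nat \<Rightarrow> real \<Rightarrow> (real \<Rightarrow> real) \<Rightarrow> real \<Rightarrow> real" where
  "fdiff 0 s g x = g x"
| "fdiff (Suc n) s g x = fdiff n s g (x + s) - fdiff n s g x"

lemma fdiff_eq_sum: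
  "fdiff n s g x = (-1) ^ n * (\<Sum>i\<le>n. (-1) ^ i * real (n choose i) * g (x + real i * s))"
proof (induction n arbitrary: x)
  case 0
  then show ?case by simp
next
  case (Suc n)
  define t where "t i = g (x + real i * s)" for i
  have 1: "g (x + s + real i * s) = t (Suc i)" for i
    by (simp add: t_def algebra_simps)
  have "(\<Sum>i\<le>Suc n. (-1) ^ i * real (Suc n choose i) * t i)
      = t 0 + (\<Sum>i\<le>n. (-1) ^ Suc i * real (Suc n choose Suc i) * t (Suc i))"
    by (subst sum.atMost_Suc_shift) simp
  also have "\<dots> = t 0 + (\<Sum>i\<le>n. (-1) ^ Suc i * real (n choose Suc i) * t (Suc i))
      - (\<Sum>i\<le>n. (-1) ^ i * real (n choose i) * t (Suc i))"
    by (simp add: algebra_simps sum_subtractf sum.distrib sum_negf)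
  also have "t 0 + (\<Sum>i\<le>n. (-1) ^ Suc i * real (n choose Suc i) * t (Suc i))
      = (\<Sum>i\<le>Suc n. (-1) ^ i * real (n choose i) * t i)"
    by (subst sum.atMost_Suc_shift) simp
  also have "\<dots> = (\<Sum>i\<le>n. (-1) ^ i * real (n choose i) * t i)"
    by simp
  finally show ?case
    unfolding fdiff.simps Suc.IH 1 unfolding t_def[symmetric]
    by (simp only: power_Suc) (simp add: algebra_simps)
qed

lemma fdiff_shrink: "fdiff n s (\<lambda>t. h (x + c * t)) t = fdiff n (c * s) h (x + c * t)"
  by (induction n arbitrary: t) (simp_all add: algebra_simps)

lemma fdiff_add: "fdiff n s (\<lambda>t. f t + g t) x = fdiff n s f x + fdiff n s g x"
  by (induction n arbitrary: x) simp_all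

lemma fdiff_minus: "fdiff n s (\<lambda>t. f t - g t) x = fdiff n s f x - fdiff n s g x"
  by (induction n arbitrary: x) simp_all

lemma fdiff_cmult: "fdiff n s (\<lambda>t. c * f t) x = c * fdiff n s f x"
  by (induction n arbitrary: x) (simp_all add: algebra_simps)

lemma fdiff_sum: "fdiff n s (\<lambda>t. \<Sum>i\<in>I. f i t) x = (\<Sum>i\<in>I. fdiff n s (f i) x)"
  by (induction n arbitrary: x) (simp_all add: sum_subtractf)

lemma DERIV_fdiff:
  assumes "\<And>x. DERIV f x :> f' x"
  shows "DERIV (fdiff n s f) x :> fdiff n s f' x"
proof (induction n arbitrary: x)
  case 0
  then show ?case using assms by simp
next
  case (Suc n)
  have "DERIV (\<lambda>x. fdiff n s f (x + s) - fdiff n s f x) x :> fdiff n s f' (x + s) - fdiff n s f' x"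
    by (intro DERIV_diff Suc Suc[of "x + s", unfolded DERIV_shift])
  then show ?case by simp
qed

text \<open>One derivative at a time: the classical mean value theorem removes the outermost
  difference, and differentiation commutes with the remaining ones.\<close>

lemma fdiff_mvt:
  assumes "\<And>i x. i < n \<Longrightarrow> DERIV (G i) x :> G (Suc i) x" and "s > 0" "n > 0"
  shows "\<exists>\<xi>. x < \<xi> \<and> \<xi> < x + real n * s \<and> fdiff n s (G 0) x = s ^ n * G n \<xi>"
  using assms
proof (induction n arbitrary: G x)
  case 0
  then show ?case by simp
next
  case (Suc n)
  have "DERIV (G 0) x :> G (Suc 0) x" for x
    using Suc.prems by simp
  from DERIV_fdiff[OF this]
  have "DERIV (fdiff n s (G 0)) t :> fdiff n s (G (Suc 0)) t" for t .
  then obtain \<eta> where eta: "x < \<eta>" "\<eta> < x + s"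
    "fdiff n s (G 0) (x + s) - fdiff n s (G 0) x = s * fdiff n s (G (Suc 0)) \<eta>"
    using MVT2[of x "x + s" "fdiff n s (G 0)" "fdiff n s (G (Suc 0))"] \<open>s > 0\<close> by auto
  show ?case
  proof (cases "n = 0")
    case True
    then show ?thesis using eta by auto
  next
    case False
    obtain \<xi> where "\<eta> < \<xi>" "\<xi> < \<eta> + real n * s"
      "fdiff n s (G (Suc 0)) \<eta> = s ^ n * G (Suc n) \<xi>"
      using Suc.IH[of "\<lambda>i. G (Suc i)" \<eta>] Suc.prems False by auto
    then show ?thesis
      using eta by (intro exI[of _ \<xi>]) (auto simp: algebra_simps)
  qed
qed

lemma fdiff_poly_eq_0:
  assumes "degree P < n" "s > 0"
  shows "fdiff n s (poly P) x = 0"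
proof -
  have "DERIV (poly ((pderiv ^^ i) P)) x :> poly ((pderiv ^^ Suc i) P) x" for i x
    by simp
  then obtain \<xi> where "fdiff n s (poly ((pderiv ^^ 0) P)) x = s ^ n * poly ((pderiv ^^ n) P) \<xi>"
    using fdiff_mvt[of n "\<lambda>i. poly ((pderiv ^^ i) P)" s x] assms by auto
  moreover have "(pderiv ^^ n) P = 0"
    using assms(1) by (intro poly_eqI) (simp add: coeff_higher_pderiv coeff_eq_0)
  ultimately show ?thesis by simp
qed

lemma DERIV_power_div_fact:
  assumes "j < k"
  shows "DERIV (\<lambda>t :: real. t ^ (k - j) / fact (k - j)) t :> t ^ (k - Suc j) / fact (k - Suc j)"
proof -
  obtain l where l: "k - j = Suc l" "k - Suc j = l"
    using assms by (metis Suc_diff_Suc)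
  have "real (Suc l) * t ^ (Suc l - Suc 0) / fact (Suc l) = t ^ l / fact l"
    unfolding fact_Suc by (simp del: of_nat_Suc)
  then show ?thesis
    using DERIV_cdivide[OF DERIV_pow[of "Suc l" t], of "fact (Suc l)"] unfolding l by metis
qed

lemma fdiff_power_self:
  assumes "s > 0"
  shows "fdiff k s (\<lambda>t. t ^ k / fact k) x = s ^ k"
proof (cases "k = 0")
  case False
  show ?thesis
    using fdiff_mvt[of k "\<lambda>i t. t ^ (k - i) / fact (k - i)" s x, OF DERIV_power_div_fact assms] False
    by auto
qed auto

text \<open>Meant for a \<open>k\<close>-fold antiderivative \<open>F\<close> of \<open>g\<close>:
  each quotient is then an average of \<open>g\<close> against a B-spline, and the alternating
  binomial weights leave an error that is an average of \<open>k\<close>-th differences of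
  \<open>g\<close>.\<close>

definition steklov :: "nat \<Rightarrow> real \<Rightarrow> (real \<Rightarrow> real) \<Rightarrow> real \<Rightarrow> real" where
  "steklov k s F x =
     (\<Sum>i=1..k. (-1) ^ Suc i * real (k choose i) / (real i * s) ^ k * fdiff k (real i * s) F x)"

lemma DERIV_steklov:
  assumes "\<And>x. DERIV F x :> F' x"
  shows "DERIV (steklov k s F) x :> steklov k s F' x"
  unfolding steklov_def
  by (intro DERIV_sum DERIV_cmult DERIV_fdiff assms)

text \<open>As a function of the step \<open>t\<close>, \<open>fdiff k t (G k) x\<close> is up to sign the \<open>k\<close>-th derivative of the function
  \<open>\<Psi> 0\<close> below, whose own \<open>k\<close>-th difference at 0 is the error of the Steklov mean.\<close>

lemma steklov_error:
  assumes G: "\<And>i x. i < k \<Longrightarrow> DERIV (G i) x :> G (Suc i) x" and "s > 0" "k > 0"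
  shows "\<exists>\<xi>>0. \<xi> < real k * s \<and> \<bar>G k x - steklov k s (G 0) x\<bar> = \<bar>fdiff k \<xi> (G k) x\<bar>"
proof -
  define \<Psi> where "\<Psi> j t = (\<Sum>i=1..k. (-1) ^ i * real (k choose i) / real i ^ k *
      (real i ^ j * G j (x + real i * t))) + G k x * (t ^ (k - j) / fact (k - j))" for j t
  have D: "DERIV (\<Psi> j) t :> \<Psi> (Suc j) t" if "j < k" for j t
  proof -
    have 1: "DERIV (\<lambda>t. G j (x + real i * t)) t :> G (Suc j) (x + real i * t) * real i" for i
      by (rule DERIV_chain2[of "G j"], rule G[OF that]) (auto intro!: derivative_eq_intros)
    note 2 = DERIV_power_div_fact[OF that, of t]
    show ?thesis
      unfolding \<Psi>_def power_Suc2 mult.assoc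
      by (intro DERIV_add DERIV_sum DERIV_cmult 2)
         (use 1 in \<open>simp add: mult.commute\<close>)
  qed
  obtain \<xi> where xi: "0 < \<xi>" "\<xi> < real k * s" "fdiff k s (\<Psi> 0) 0 = s ^ k * \<Psi> k \<xi>"
    using fdiff_mvt[of k \<Psi> s 0, OF D] assms by auto
  have "fdiff k s (\<Psi> 0) 0 =
      (\<Sum>i=1..k. (-1) ^ i * real (k choose i) / real i ^ k * fdiff k (real i * s) (G 0) x)
        + G k x * s ^ k"
    unfolding \<Psi>_def
    by (simp only: fdiff_add fdiff_sum fdiff_cmult fdiff_shrink power_0 mult_1 diff_zero
        fdiff_power_self[OF \<open>s > 0\<close>] mult_zero_right add_0_right)
  also have "\<dots> = s ^ k * (G k x - steklov k s (G 0) x)"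
    using \<open>s > 0\<close> by (simp add: steklov_def algebra_simps sum_distrib_left power_mult_distrib sum_negf)
  finally have "G k x - steklov k s (G 0) x = \<Psi> k \<xi>"
    using xi(3) \<open>s > 0\<close> by simp
  moreover have "\<bar>\<Psi> k \<xi>\<bar> = \<bar>fdiff k \<xi> (G k) x\<bar>"
  proof -
    have "\<Psi> k \<xi> = (\<Sum>i=1..k. (-1) ^ i * real (k choose i) * G k (x + real i * \<xi>)) + G k x"
      unfolding \<Psi>_def by (auto intro!: sum.cong)
    also have "\<dots> = (\<Sum>i\<le>k. (-1) ^ i * real (k choose i) * G k (x + real i * \<xi>))"
      by (simp add: atMost_atLeast0 sum.atLeast_Suc_atMost[of 0 k])
    finally show ?thesis by (simp add: fdiff_eq_sum abs_mult)
  qed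
  ultimately show ?thesis using xi by metis
qed

lemma iterated_antiderivative:
  fixes g :: "real \<Rightarrow> real"
  assumes "continuous_on UNIV g"
  shows "\<exists>G. G k = g \<and> (\<forall>i<k. \<forall>x. DERIV (G i) x :> G (Suc i) x)"
  using assms
proof (induction k arbitrary: g)
  case 0
  then show ?case by auto
next
  case (Suc k)
  have "\<exists>F. \<forall>x :: real. -\<infinity> < ereal x \<longrightarrow> ereal x < \<infinity> \<longrightarrow> (F has_vector_derivative g x) (at x)"
    by (intro einterval_antiderivative)
       (use Suc.prems in \<open>auto simp: continuous_on_eq_continuous_at\<close>)
  then obtain F where F: "\<And>x. DERIV F x :> g x"
    by (auto simp: has_real_derivative_iff_has_vector_derivative)
  then have "continuous_on UNIV F"
    by (meson DERIV_continuous_on DERIV_subset subset_UNIV)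
  from Suc.IH[OF this] obtain G where G: "G k = F" "\<forall>i<k. \<forall>x. DERIV (G i) x :> G (Suc i) x"
    by blast
  show ?case
    by (rule exI[of _ "G(Suc k := g)"]) (use F G in \<open>auto simp: less_Suc_eq\<close>)
qed

lemma poly_taylor_exists:
  fixes d :: "nat \<Rightarrow> real"
  assumes "k > 0"
  shows "\<exists>T. degree T < k \<and> (\<forall>x. poly T x = (\<Sum>j<k. d j * (x - a) ^ j))"
proof (intro exI conjI allI)
  show "degree (\<Sum>j<k. smult (d j) ([:-a, 1:] ^ j)) < k"
  proof (rule degree_sum_less)
    show "degree (smult (d j) ([:-a, 1:] ^ j)) < k" if "j \<in> {..<k}" for j
      using that by (auto simp: degree_linear_power intro: le_less_trans[OF degree_smult_le])
  qed fact
qed (simp add: poly_sum)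

text \<open>Whitney's inequality. The Taylor polynomial at \<open>a\<close> of a Steklov mean of \<open>g\<close> is close to \<open>g\<close> on all of
  \<open>[a, b]\<close> but a short piece at the right end; there the difference \<open>fdiff k\<close>, which annihilates the polynomial,
  extrapolates the estimate from the points to the left.\<close>

theorem whitney:
  assumes "k > 0"
  shows "\<exists>C>0. \<forall>a b g W. a < b \<longrightarrow> continuous_on {a..b} g \<longrightarrow>
    (\<forall>x u. 0 < u \<and> a \<le> x \<and> x + real k * u \<le> b \<longrightarrow> \<bar>fdiff k u g x\<bar> \<le> W) \<longrightarrow>
    (\<exists>P. degree P < k \<and> (\<forall>x\<in>{a..b}. \<bar>g x - poly P x\<bar> \<le> C * W))"
proof -
  \<comment> \<open>In \<open>C1\<close> the 1 is the error of the Steklov mean, and the rest bounds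
    the Taylor remainder, where \<open>k^2 (k + 1)\<close> is \<open>(b - a) / s\<close>.
    \<open>C\<close> adds the extrapolation by a \<open>k\<close>-th difference, whose other
    coefficients sum to at most \<open>2 ^ k\<close>.\<close>
  define C1 :: real where "C1 = 1 + 2 ^ k * (real k ^ 2 * (real k + 1)) ^ k"
  define C where "C = 1 + 2 ^ k * C1"
  have C1: "C1 \<ge> 1" by (simp add: C1_def)
  have C: "C1 \<le> C"
    using mult_right_mono[of 1 "2 ^ k" C1] C1 one_le_power[of "2 :: real" k] unfolding C_def by linarith
  show ?thesis
  proof (intro exI[of _ C] conjI allI impI)
    show "C > 0" using C1 C by simp
    fix a b :: real and g W
    assume ab: "a < b" and cont: "continuous_on {a..b} g"
      and "\<forall>x u. 0 < u \<and> a \<le> x \<and> x + real k * u \<le> b \<longrightarrow> \<bar>fdiff k u g x\<bar> \<le> W"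
    then have W: "\<bar>fdiff k u g x\<bar> \<le> W" if "0 < u" "a \<le> x" "x + real k * u \<le> b" for x u
      using that by blast
    \<comment> \<open>A difference of step \<open>\<delta>\<close> fits in \<open>[a, b]\<close>
      from any start in \<open>[a, a + \<delta>]\<close>, and every difference of step at most
      \<open>k * s\<close> started left of \<open>b - \<delta>\<close> stays inside.\<close>
    define \<delta> where "\<delta> = (b - a) / (real k + 1)"
    define s where "s = \<delta> / real k ^ 2"
    have \<delta>: "\<delta> > 0" "a + real k * \<delta> + \<delta> = b"
    proof -
      have "(real k + 1) * \<delta> = b - a" by (simp add: \<delta>_def add_nonneg_eq_0_iff)
      then show "a + real k * \<delta> + \<delta> = b" by (simp add: algebra_simps)
    qed (use ab in \<open>simp add: \<delta>_def\<close>)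
    have s: "s > 0" "real k ^ 2 * s = \<delta>" "b - a = s * (real k ^ 2 * (real k + 1))"
    proof -
      show "real k ^ 2 * s = \<delta>" using \<open>k > 0\<close> by (simp add: s_def)
      then have "s * (real k ^ 2 * (real k + 1)) = \<delta> * (real k + 1)" by (metis mult.assoc mult.commute)
      then show "b - a = s * (real k ^ 2 * (real k + 1))" using \<delta>(2) by (simp add: algebra_simps)
    qed (use \<delta> \<open>k > 0\<close> in \<open>simp add: s_def\<close>)
    have W0: "W \<ge> 0"
      using W[of \<delta> a] \<delta> by linarith
    \<comment> \<open>Constant continuation beyond the end points, so that antiderivatives exist on
      the whole line.\<close>
    define g' where "g' = (\<lambda>x. g (max a (min b x)))"
    have g': "g' x = g x" if "x \<in> {a..b}" for x
      using that by (auto simp: g'_def max_def min_def intro!: arg_cong[of _ _ g])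
    have "continuous_on UNIV g'"
      unfolding g'_def using ab
      by (intro continuous_on_compose2[OF cont] continuous_intros) auto
    then obtain G where G: "G k = g'" "\<And>i x. i < k \<Longrightarrow> DERIV (G i) x :> G (Suc i) x"
      using iterated_antiderivative[of g' k] by blast
    have fd: "fdiff k u g' x = fdiff k u g x" if "0 < u" "a \<le> x" "x + real k * u \<le> b" for x u
    proof -
      have "x + real i * u \<in> {a..b}" if "i \<le> k" for i
      proof -
        have "real i * u \<le> real k * u" using that \<open>0 < u\<close> by simp
        moreover have "0 \<le> real i * u" using \<open>0 < u\<close> by simp
        ultimately show ?thesis using \<open>a \<le> x\<close> \<open>x + real k * u \<le> b\<close> by auto
      qed
      then show ?thesis
        unfolding fdiff_eq_sum by (intro arg_cong2[where f = "(*)"] sum.cong) (auto simp: g')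
    qed
    define S where "S j = steklov k s (G j)" for j
    have DS: "DERIV (S j) x :> S (Suc j) x" if "j < k" for j x
      unfolding S_def using G(2)[OF that] by (rule DERIV_steklov)
    have err: "\<bar>g x - S 0 x\<bar> \<le> W" if "x \<in> {a..b-\<delta>}" for x
    proof -
      obtain \<xi> where xi: "\<xi> > 0" "\<xi> < real k * s" "\<bar>G k x - S 0 x\<bar> = \<bar>fdiff k \<xi> (G k) x\<bar>"
        using steklov_error[of k G s x, OF G(2) s(1) \<open>k > 0\<close>] unfolding S_def by blast
      have "real k * \<xi> \<le> real k * (real k * s)" using xi by (intro mult_left_mono) auto
      also have "\<dots> = \<delta>" using s by (simp add: power2_eq_square mult.assoc)
      finally have "a \<le> x" "x + real k * \<xi> \<le> b" using that by auto
      then show ?thesis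
        using xi W[of \<xi> x] fd[of \<xi> x] that \<delta> by (simp add: G g')
    qed
    have Sk: "\<bar>S k x\<bar> \<le> 2 ^ k * W / s ^ k" if "x \<in> {a..b-\<delta>}" for x
    proof -
      have "\<bar>S k x\<bar> \<le> (\<Sum>i=1..k. \<bar>(-1) ^ Suc i * real (k choose i) / (real i * s) ^ k * fdiff k (real i * s) (G k) x\<bar>)"
        unfolding S_def steklov_def by (rule sum_abs)
      also have "\<dots> \<le> (\<Sum>i=1..k. real (k choose i) * (W / s ^ k))"
      proof (rule sum_mono)
        fix i assume i: "i \<in> {1..k}"
        have "real k * (real i * s) \<le> real k * (real k * s)"
          using i s by (intro mult_left_mono mult_right_mono) auto
        also have "\<dots> = \<delta>" using s by (simp add: power2_eq_square mult.assoc)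
        finally have *: "x + real k * (real i * s) \<le> b" "0 < real i * s" "a \<le> x"
          using that i s by auto
        have "1 / (real i * s) ^ k \<le> 1 / s ^ k"
          using i s by (intro divide_left_mono power_mono mult_pos_pos zero_less_power) auto
        then have "1 / (real i * s) ^ k * \<bar>fdiff k (real i * s) (G k) x\<bar> \<le> 1 / s ^ k * W"
          using s W[of "real i * s" x] fd[of "real i * s" x] * by (intro mult_mono) (auto simp: G)
        then have "real (k choose i) * (1 / (real i * s) ^ k * \<bar>fdiff k (real i * s) (G k) x\<bar>)
             \<le> real (k choose i) * (1 / s ^ k * W)"
          by (rule mult_left_mono) simp
        then show "\<bar>(-1) ^ Suc i * real (k choose i) / (real i * s) ^ k * fdiff k (real i * s) (G k) x\<bar>
             \<le> real (k choose i) * (W / s ^ k)"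
          using s by (simp add: abs_mult power_abs)
      qed
      also have "\<dots> = (\<Sum>i=1..k. real (k choose i)) * (W / s ^ k)"
        by (rule sum_distrib_right[symmetric])
      also have "\<dots> \<le> 2 ^ k * (W / s ^ k)"
      proof (rule mult_right_mono)
        have "(\<Sum>i=1..k. real (k choose i)) \<le> (\<Sum>i\<le>k. real (k choose i))"
          by (rule sum_mono2) auto
        also have "\<dots> = 2 ^ k"
          using choose_row_sum[of k] by (metis of_nat_numeral of_nat_power of_nat_sum)
        finally show "(\<Sum>i=1..k. real (k choose i)) \<le> 2 ^ k" .
      qed (use W0 s in auto)
      finally show ?thesis by simp
    qed
    obtain T where T: "degree T < k" "\<And>x. poly T x = (\<Sum>j<k. S j a / fact j * (x - a) ^ j)"
      using poly_taylor_exists[OF \<open>k > 0\<close>, of "\<lambda>j. S j a / fact j" a] by blast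
    have ST: "\<bar>S 0 x - poly T x\<bar> \<le> (C1 - 1) * W" if "x \<in> {a..b-\<delta>}" for x
    proof (cases "x = a")
      case True
      have "poly T a = S 0 a"
        unfolding T(2) using \<open>k > 0\<close> by (cases k) (simp_all add: sum.lessThan_Suc_shift)
      then show ?thesis using True W0 by (simp add: C1_def)
    next
      case False
      have "\<exists>t. a < t \<and> t < x \<and> S 0 x = (\<Sum>j<k. S j a / fact j * (x - a) ^ j) + S k t / fact k * (x - a) ^ k"
        by (rule Taylor_up[of k S "S 0" a x a]) (use DS \<open>k > 0\<close> that False in auto)
      then obtain t where t: "a < t" "t < x" "S 0 x = poly T x + S k t / fact k * (x - a) ^ k"
        unfolding T(2) by blast
      have "\<bar>S 0 x - poly T x\<bar> = \<bar>S k t\<bar> * (\<bar>x - a\<bar> ^ k / fact k)"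
        using t(3) by (simp add: abs_mult power_abs)
      also have "\<dots> \<le> (2 ^ k * W / s ^ k) * (b - a) ^ k"
      proof (rule mult_mono)
        show "\<bar>S k t\<bar> \<le> 2 ^ k * W / s ^ k" using t that by (intro Sk) auto
        have "\<bar>x - a\<bar> ^ k / fact k \<le> \<bar>x - a\<bar> ^ k / 1"
          by (intro divide_left_mono) auto
        also have "\<dots> \<le> (b - a) ^ k" using that \<delta> by (auto intro!: power_mono)
        finally show "\<bar>x - a\<bar> ^ k / fact k \<le> (b - a) ^ k" .
      qed (use W0 s in auto)
      also have "\<dots> = (C1 - 1) * W"
        using s(1) unfolding s(3) C1_def by (simp add: power_mult_distrib)
      finally show ?thesis .
    qed
    have near: "\<bar>g x - poly T x\<bar> \<le> C1 * W" if "x \<in> {a..b-\<delta>}" for x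
      using err[OF that] ST[OF that] by (simp add: algebra_simps)
    have far: "\<bar>g x - poly T x\<bar> \<le> C * W" if "x \<in> {b-\<delta>..b}" for x
    proof -
      \<comment> \<open>\<open>b - \<delta> = a + k * \<delta>\<close> gives
        \<open>a \<le> y\<close>; the points of the difference before \<open>x\<close> lie left of
        \<open>b - \<delta>\<close>, where \<open>near\<close> applies.\<close>
      define y where "y = x - real k * \<delta>"
      define e where "e t = g t - poly T t" for t
      have y: "a \<le> y" "y + real k * \<delta> \<le> b" using that \<delta> by (auto simp: y_def)
      have "fdiff k \<delta> e y = fdiff k \<delta> g y"
        unfolding e_def by (simp add: fdiff_minus fdiff_poly_eq_0 T(1) \<delta>)
      then have "\<bar>fdiff k \<delta> e y\<bar> \<le> W" using W[of \<delta> y] y \<delta> by simp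
      moreover have "fdiff k \<delta> e y = e x + (-1) ^ k * (\<Sum>i<k. (-1) ^ i * real (k choose i) * e (y + real i * \<delta>))"
      proof -
        have "{..k} = insert k {..<k}" by auto
        then show ?thesis by (simp add: fdiff_eq_sum y_def algebra_simps)
      qed
      moreover have "\<bar>\<Sum>i<k. (-1) ^ i * real (k choose i) * e (y + real i * \<delta>)\<bar> \<le> 2 ^ k * (C1 * W)"
      proof -
        have "\<bar>\<Sum>i<k. (-1) ^ i * real (k choose i) * e (y + real i * \<delta>)\<bar>
           \<le> (\<Sum>i<k. \<bar>(-1) ^ i * real (k choose i) * e (y + real i * \<delta>)\<bar>)"
          by (rule sum_abs)
        also have "\<dots> \<le> (\<Sum>i<k. real (k choose i) * (C1 * W))"
        proof (rule sum_mono)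
          fix i assume i: "i \<in> {..<k}"
          have "real i + 1 \<le> real k" using i by auto
          then have "(real i + 1) * \<delta> \<le> real k * \<delta>" using \<delta> by (intro mult_right_mono) auto
          then have "y + real i * \<delta> \<le> b - \<delta>" using that by (simp add: y_def algebra_simps)
          moreover have "0 \<le> real i * \<delta>" using \<delta> by simp
          ultimately have "\<bar>e (y + real i * \<delta>)\<bar> \<le> C1 * W"
            unfolding e_def using y by (intro near) auto
          then show "\<bar>(-1) ^ i * real (k choose i) * e (y + real i * \<delta>)\<bar> \<le> real (k choose i) * (C1 * W)"
            by (simp add: abs_mult mult_left_mono power_abs)
        qed
        also have "\<dots> \<le> (\<Sum>i\<le>k. real (k choose i) * (C1 * W))"
          using W0 C1 by (intro sum_mono2) auto
        also have "\<dots> = 2 ^ k * (C1 * W)"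
          unfolding sum_distrib_right[symmetric] using choose_row_sum[of k]
          by (metis of_nat_numeral of_nat_power of_nat_sum)
        finally show ?thesis .
      qed
      ultimately have "\<bar>e x\<bar> \<le> W + 2 ^ k * (C1 * W)"
        using abs_triangle_ineq4[of "fdiff k \<delta> e y"
            "(-1) ^ k * (\<Sum>i<k. (-1) ^ i * real (k choose i) * e (y + real i * \<delta>))"]
        by (simp add: abs_mult power_abs)
      then show ?thesis by (simp add: C_def e_def algebra_simps)
    qed
    have "\<bar>g x - poly T x\<bar> \<le> C * W" if "x \<in> {a..b}" for x
    proof (cases "x \<le> b - \<delta>")
      case True
      then have "\<bar>g x - poly T x\<bar> \<le> C1 * W" using that by (intro near) auto
      also have "\<dots> \<le> C * W" using C W0 by (intro mult_right_mono)
      finally show ?thesis .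
    qed (use that far in auto)
    then show "\<exists>P. degree P < k \<and> (\<forall>x\<in>{a..b}. \<bar>g x - poly P x\<bar> \<le> C * W)"
      using T(1) by blast
  qed
qed

subsection \<open>A Markov inequality\<close>

text \<open>Dividing by \<open>x - a\<close> lowers the degree, and the quotient is under control on
  the right half of the interval, where \<open>x - a\<close> is at least half the length. Hence the
  induction moves \<open>a\<close> while \<open>b\<close> stays; \<open>[a, b]\<close> inside
  \<open>[0, 1]\<close> keeps the factor \<open>a\<close> in the product at most 1.\<close>

lemma poly_coeff_bound:
  fixes a b :: real
  assumes "0 \<le> a" "a < b" "b \<le> 1"
  shows "\<exists>C\<ge>0. \<forall>p M. degree p \<le> k \<longrightarrow> (\<forall>x\<in>{a..b}. \<bar>poly p x\<bar> \<le> M) \<longrightarrow> (\<forall>i. \<bar>coeff p i\<bar> \<le> C * M)"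
  using assms
proof (induction k arbitrary: a)
  case 0
  show ?case
  proof (intro exI[of _ 1] conjI allI impI)
    fix p :: "real poly" and M i
    assume "degree p \<le> 0" and M: "\<forall>x\<in>{a..b}. \<bar>poly p x\<bar> \<le> M"
    then obtain c where "p = [:c:]" by (metis degree_eq_zeroE le_zero_eq)
    moreover have "\<bar>poly p a\<bar> \<le> M" using M 0 by simp
    ultimately show "\<bar>coeff p i\<bar> \<le> 1 * M" by (cases i) auto
  qed simp
next
  case (Suc k)
  define c where "c = (a + b) / 2"
  have c: "a < c" "c < b" "0 \<le> c" "c - a = (b - a) / 2" using Suc.prems by (auto simp: c_def field_simps)
  obtain C where C: "C \<ge> 0"
    "\<And>p M i. degree p \<le> k \<Longrightarrow> (\<forall>x\<in>{c..b}. \<bar>poly p x\<bar> \<le> M) \<Longrightarrow> \<bar>coeff p i\<bar> \<le> C * M"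
    using Suc.IH[of c] c Suc.prems by blast
  show ?case
  proof (intro exI[of _ "1 + 2 * (C * (4 / (b - a)))"] conjI allI impI)
    fix p :: "real poly" and M i
    assume deg: "degree p \<le> Suc k" and M: "\<forall>x\<in>{a..b}. \<bar>poly p x\<bar> \<le> M"
    define q where "q = synthetic_div p a"
    have p: "p = [:-a, 1:] * q + [:poly p a:]"
      unfolding q_def by (rule synthetic_div_correct'[symmetric])
    have Ma: "\<bar>poly p a\<bar> \<le> M" using M Suc.prems by simp
    have "\<bar>poly q x\<bar> \<le> 4 / (b - a) * M" if "x \<in> {c..b}" for x
    proof -
      have "(x - a) * poly q x = poly p x - poly p a"
        by (subst (1) p) (simp add: algebra_simps)
      then have "(x - a) * \<bar>poly q x\<bar> = \<bar>poly p x - poly p a\<bar>"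
        using that c by (simp add: abs_mult[symmetric] abs_mult_pos')
      also have "\<dots> \<le> 2 * M" using Ma M that c by (smt (verit) atLeastAtMost_iff)
      finally have "(x - a) * \<bar>poly q x\<bar> \<le> 2 * M" .
      moreover have "(b - a) / 2 * \<bar>poly q x\<bar> \<le> (x - a) * \<bar>poly q x\<bar>"
        using that c by (intro mult_right_mono) auto
      ultimately show ?thesis using Suc.prems by (simp add: field_simps)
    qed
    moreover have "degree q \<le> k" using deg by (simp add: q_def degree_synthetic_div)
    ultimately have q: "\<bar>coeff q j\<bar> \<le> C * (4 / (b - a) * M)" for j
      by (intro C(2)) auto
    have "coeff p i = coeff (pCons 0 q) i - a * coeff q i + coeff [:poly p a:] i"
      by (subst p) simp
    moreover have "\<bar>coeff (pCons 0 q) i\<bar> \<le> C * (4 / (b - a) * M)"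
      using q[of "i - 1"] q[of 0] by (cases i) auto
    moreover have "\<bar>a * coeff q i\<bar> \<le> C * (4 / (b - a) * M)"
      using q[of i] Suc.prems mult_mono[of a 1 "\<bar>coeff q i\<bar>" "C * (4 / (b - a) * M)"] by (simp add: abs_mult)
    moreover have "\<bar>coeff [:poly p a:] i\<bar> \<le> M"
      using Ma by (cases i) auto
    ultimately have "\<bar>coeff p i\<bar> \<le> M + 2 * (C * (4 / (b - a) * M))" by linarith
    then show "\<bar>coeff p i\<bar> \<le> (1 + 2 * (C * (4 / (b - a)))) * M" by (simp add: algebra_simps)
  qed (use C(1) Suc.prems in auto)
qed

text \<open>From \<open>x\<close>, one direction leaves at least half of the interval. Rescaling a
  segment of that length to \<open>[0, 1]\<close> turns the derivative at \<open>x\<close> into a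
  linear coefficient, which \<open>poly_coeff_bound\<close> controls.\<close>

lemma markov_deriv:
  "\<exists>C\<ge>0. \<forall>p (a::real) b M. degree p \<le> k \<longrightarrow> a < b \<longrightarrow> (\<forall>x\<in>{a..b}. \<bar>poly p x\<bar> \<le> M) \<longrightarrow>
    (\<forall>x\<in>{a..b}. \<bar>poly (pderiv p) x\<bar> \<le> C * M / (b - a))"
proof -
  obtain C :: real where C: "C \<ge> 0"
    "\<And>p M i. degree p \<le> k \<Longrightarrow> (\<forall>x\<in>{0..1::real}. \<bar>poly p x\<bar> \<le> M) \<Longrightarrow> \<bar>coeff p i\<bar> \<le> C * M"
    using poly_coeff_bound[of 0 1 k] by auto
  show ?thesis
  proof (intro exI[of _ "2 * C"] conjI allI impI ballI)
    fix p and a b M x :: real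
    assume deg: "degree p \<le> k" and ab: "a < b" and M: "\<forall>x\<in>{a..b}. \<bar>poly p x\<bar> \<le> M" and x: "x \<in> {a..b}"
    define \<sigma> where "\<sigma> = (if x \<le> (a + b) / 2 then (b - a) / 2 else - (b - a) / 2)"
    define P where "P = pcompose p [:x, \<sigma>:]"
    have "\<bar>poly P y\<bar> \<le> M" if "y \<in> {0..1}" for y
    proof -
      have "y * ((b - a) / 2) \<le> 1 * ((b - a) / 2)" "0 \<le> y * ((b - a) / 2)"
        using that ab by (intro mult_right_mono mult_nonneg_nonneg; simp)+
      then have "x + y * \<sigma> \<in> {a..b}"
        using x by (auto simp: \<sigma>_def field_simps)
      then show ?thesis using M by (simp add: P_def poly_pcompose)
    qed
    moreover have "degree P \<le> k"
      using deg by (simp add: P_def degree_pcompose)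
    ultimately have "\<bar>coeff P 1\<bar> \<le> C * M" by (intro C(2)) auto
    moreover have "coeff P 1 = poly (pderiv p) x * \<sigma>"
    proof -
      have "coeff P 1 = poly (pderiv P) 0" by (simp add: poly_0_coeff_0 coeff_pderiv)
      then show ?thesis by (simp add: P_def pderiv_pcompose poly_pcompose pderiv_pCons)
    qed
    moreover have "\<bar>\<sigma>\<bar> = (b - a) / 2" using ab by (simp add: \<sigma>_def)
    ultimately have "\<bar>poly (pderiv p) x\<bar> * ((b - a) / 2) \<le> C * M" by (metis abs_mult)
    then show "\<bar>poly (pderiv p) x\<bar> \<le> 2 * C * M / (b - a)" using ab by (simp add: field_simps)
  qed (use C(1) in simp)
qed

lemma markov_higher:
  "\<exists>C\<ge>0. \<forall>p (a::real) b M. degree p \<le> k \<longrightarrow> a < b \<longrightarrow> (\<forall>x\<in>{a..b}. \<bar>poly p x\<bar> \<le> M) \<longrightarrow>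
    (\<forall>x\<in>{a..b}. \<bar>poly ((pderiv ^^ s) p) x\<bar> \<le> C * M / (b - a) ^ s)"
proof (induction s)
  case 0
  show ?case by (intro exI[of _ 1]) auto
next
  case (Suc s)
  obtain C where C: "C \<ge> 0" "\<And>p (a::real) b M x. degree p \<le> k \<Longrightarrow> a < b \<Longrightarrow>
      (\<forall>x\<in>{a..b}. \<bar>poly p x\<bar> \<le> M) \<Longrightarrow> x \<in> {a..b} \<Longrightarrow> \<bar>poly ((pderiv ^^ s) p) x\<bar> \<le> C * M / (b - a) ^ s"
    using Suc.IH by blast
  obtain E where E: "E \<ge> 0" "\<And>p (a::real) b M x. degree p \<le> k \<Longrightarrow> a < b \<Longrightarrow>
      (\<forall>x\<in>{a..b}. \<bar>poly p x\<bar> \<le> M) \<Longrightarrow> x \<in> {a..b} \<Longrightarrow> \<bar>poly (pderiv p) x\<bar> \<le> E * M / (b - a)"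
    using markov_deriv[of k] by blast
  show ?case
  proof (intro exI[of _ "E * C"] conjI allI impI ballI)
    fix p and a b M x :: real
    assume deg: "degree p \<le> k" and ab: "a < b" and M: "\<forall>x\<in>{a..b}. \<bar>poly p x\<bar> \<le> M" and x: "x \<in> {a..b}"
    have "\<bar>poly (pderiv ((pderiv ^^ s) p)) x\<bar> \<le> E * (C * M / (b - a) ^ s) / (b - a)"
      using deg by (intro E(2) ab x ballI C(2) M) (auto simp: degree_higher_pderiv)
    then show "\<bar>poly ((pderiv ^^ Suc s) p) x\<bar> \<le> E * C * M / (b - a) ^ Suc s"
      by (simp add: mult_ac)
  qed (use C(1) E(1) in simp)
qed

lemma markov_uniform:
  "\<exists>C\<ge>0. \<forall>s\<le>N. \<forall>p (a::real) b M. degree p \<le> k \<longrightarrow> a < b \<longrightarrow> (\<forall>x\<in>{a..b}. \<bar>poly p x\<bar> \<le> M) \<longrightarrow>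
    (\<forall>x\<in>{a..b}. \<bar>poly ((pderiv ^^ s) p) x\<bar> \<le> C * M / (b - a) ^ s)"
proof -
  obtain C where C: "\<And>s. C s \<ge> 0" "\<And>s p (a::real) b M x. degree p \<le> k \<Longrightarrow> a < b \<Longrightarrow>
      (\<forall>x\<in>{a..b}. \<bar>poly p x\<bar> \<le> M) \<Longrightarrow> x \<in> {a..b} \<Longrightarrow> \<bar>poly ((pderiv ^^ s) p) x\<bar> \<le> C s * M / (b - a) ^ s"
    using markov_higher[of k] by metis
  show ?thesis
  proof (intro exI[of _ "\<Sum>s\<le>N. C s"] conjI allI impI ballI)
    fix s p and a b M x :: real
    assume s: "s \<le> N" and deg: "degree p \<le> k" and ab: "a < b"
      and M: "\<forall>x\<in>{a..b}. \<bar>poly p x\<bar> \<le> M" and x: "x \<in> {a..b}"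
    have "0 \<le> M" using M x by force
    moreover have "C s \<le> (\<Sum>s\<le>N. C s)" using s C(1) by (intro member_le_sum) auto
    ultimately have "C s * M / (b - a) ^ s \<le> (\<Sum>s\<le>N. C s) * M / (b - a) ^ s"
      using ab by (intro divide_right_mono mult_right_mono) auto
    then show "\<bar>poly ((pderiv ^^ s) p) x\<bar> \<le> (\<Sum>s\<le>N. C s) * M / (b - a) ^ s"
      using C(2)[OF deg ab M x, of s] by linarith
  qed (simp add: C(1) sum_nonneg)
qed

lemma poly_antiderivative:
  fixes P :: "real poly"
  shows "\<exists>Q. (pderiv ^^ r) Q = P \<and> degree Q \<le> degree P + r"
proof (induction r)
  case 0
  then show ?case by auto
next
  case (Suc r)
  then obtain Q where Q: "(pderiv ^^ r) Q = P" "degree Q \<le> degree P + r" by blast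
  define R where "R = (\<Sum>i\<le>degree Q. monom (coeff Q i / real (Suc i)) (Suc i))"
  have "pderiv R = (\<Sum>i\<le>degree Q. monom (coeff Q i) i)"
    unfolding R_def higher_pderiv_sum[of 1, simplified] pderiv_monom by (intro sum.cong) (simp_all del: of_nat_Suc)
  then have "pderiv R = Q" by (simp add: poly_as_sum_of_monoms)
  moreover have "degree R \<le> Suc (degree Q)"
    unfolding R_def by (intro degree_sum_le) (auto intro: order.trans[OF degree_monom_le])
  ultimately show ?case
    using Q by (intro exI[of _ R]) (simp add: funpow_swap1 del: funpow.simps add: funpow_Suc_right)
qed

subsection \<open>The mean value theorem for Hermite divided differences\<close>

abbreviation (input) dd :: "(nat \<Rightarrow> real \<Rightarrow> real) \<Rightarrow> (nat \<Rightarrow> real) \<Rightarrow> nat \<Rightarrow> nat \<Rightarrow> real" where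
  "dd D x p q \<equiv> divdiff D (map x [p..<Suc q])"

text \<open>\<open>divdiff\<close> discards either the first or the last node, so ranges of
  consecutive nodes are closed under the recursion.\<close>

lemma dd_rec:
  assumes "p < q" "x p < x q"
  shows "dd D x p q = (dd D x (Suc p) q - dd D x p (q - 1)) / (x q - x p)"
proof -
  have *: "map x [p..<Suc q] = x p # x (Suc p) # map x [Suc (Suc p)..<Suc q]"
    using assms by (simp add: upt_conv_Cons[of p "Suc q"] upt_conv_Cons[of "Suc p" "Suc q"] del: upt_Suc)
  have 1: "map x [Suc p..<Suc q] = x (Suc p) # map x [Suc (Suc p)..<Suc q]"
    using assms by (simp add: upt_conv_Cons[of p "Suc q"] upt_conv_Cons[of "Suc p" "Suc q"] del: upt_Suc)
  have 2: "butlast (map x [p..<Suc q]) = map x [p..<Suc (q - 1)]" "last (map x [p..<Suc q]) = x q"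
    using assms by (simp_all add: butlast_append)
  have "x q \<in> set (map x [p..<Suc q])" using assms by auto
  then have "\<not> (\<forall>z\<in>set (map x [p..<Suc q]). z = x p)" using assms by force
  then show ?thesis
    unfolding 1 unfolding 2(1)[symmetric] 2(2)[symmetric] unfolding *
    using trans[OF divdiff.simps(3) if_not_P] by blast
qed

lemma dd_const:
  assumes "p \<le> q" "\<And>i. p \<le> i \<Longrightarrow> i \<le> q \<Longrightarrow> x i = x p"
  shows "dd D x p q = D (q - p) (x p) / fact (q - p)"
proof (cases "p = q")
  case False
  then have pq: "p < q" using assms by simp
  have *: "map x [p..<Suc q] = x p # x (Suc p) # map x [Suc (Suc p)..<Suc q]"
    using pq by (simp add: upt_conv_Cons[of p "Suc q"] upt_conv_Cons[of "Suc p" "Suc q"] del: upt_Suc)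
  have "\<forall>z\<in>set (map x [p..<Suc q]). z = x p"
  proof
    fix z assume "z \<in> set (map x [p..<Suc q])"
    then obtain i where "p \<le> i" "i \<le> q" "z = x i" by (auto simp del: upt_Suc)
    then show "z = x p" using assms(2) by metis
  qed
  moreover have "Suc (length (map x [Suc (Suc p)..<Suc q])) = q - p" using pq by auto
  ultimately show ?thesis
    unfolding * using trans[OF divdiff.simps(3) if_P] by metis
qed simp

lemma dd_diff:
  "divdiff (\<lambda>i y. D i y - E i y) xs = divdiff D xs - divdiff E xs"
proof (induction D xs rule: divdiff.induct)
  case (3 D x y zs)
  show ?case
  proof (cases "\<forall>z\<in>set (x # y # zs). z = x")
    case True
    have *: "divdiff F (x # y # zs) = F (Suc (length zs)) x / fact (Suc (length zs))" for F
      by (rule trans[OF divdiff.simps(3)]) (rule if_P[OF True])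
    show ?thesis
      unfolding *[of "\<lambda>i y. D i y - E i y"] *[of D] *[of E] by (rule diff_divide_distrib)
  next
    case False
    have *: "divdiff F (x # y # zs)
        = (divdiff F (y # zs) - divdiff F (butlast (x # y # zs))) / (last (x # y # zs) - x)" for F
      by (rule trans[OF divdiff.simps(3)]) (rule if_not_P[OF False])
    show ?thesis
      unfolding *[of "\<lambda>i y. D i y - E i y"] *[of D] *[of E] 3(1)[OF False] 3(2)[OF False] diff_divide_distrib
      by linarith
  qed
qed auto

lemma Cr_on_subset:
  assumes "Cr_on n D a b" "a \<le> a'" "b' \<le> b" "k \<le> n"
  shows "Cr_on k D a' b'"
proof -
  have sub: "{a'..b'} \<subseteq> {a..b}" using assms by auto
  show ?thesis
    unfolding Cr_on_def
  proof (intro conjI allI impI ballI)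
    fix i assume "i \<le> k"
    then have "continuous_on {a..b} (D i)" using assms by (auto simp: Cr_on_def)
    then show "continuous_on {a'..b'} (D i)" by (rule continuous_on_subset[OF _ sub])
  next
    fix i y assume "i < k" "y \<in> {a'..b'}"
    then have "(D i has_real_derivative D (Suc i) y) (at y within {a..b})"
      using assms sub by (auto simp: Cr_on_def)
    then show "(D i has_real_derivative D (Suc i) y) (at y within {a'..b'})"
      by (rule DERIV_subset[OF _ sub])
  qed
qed

lemma Cr_on_poly: "Cr_on n (\<lambda>i. poly ((pderiv ^^ i) P)) a b"
  unfolding Cr_on_def
proof (intro conjI allI impI ballI)
  fix i y
  have "DERIV (poly ((pderiv ^^ i) P)) y :> poly ((pderiv ^^ Suc i) P) y" by simp
  then show "(poly ((pderiv ^^ i) P) has_real_derivative poly ((pderiv ^^ Suc i) P) y) (at y within {a..b})"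
    by (rule DERIV_subset) simp
qed (intro continuous_intros)

lemma Cr_on_diff:
  assumes "Cr_on n D a b" "Cr_on n E a b"
  shows "Cr_on n (\<lambda>i y. D i y - E i y) a b"
  using assms unfolding Cr_on_def by (simp add: continuous_on_diff DERIV_diff)

text \<open>Multiplicity is encoded by the index distance \<open>j\<close> of equal nodes. Rolle's
  theorem between distinct neighbours, and the node itself between equal ones, give zeros of the
  derivative that interlace with the nodes and meet the same hypotheses.\<close>

lemma generalized_rolle:
  assumes "Cr_on n e a b"
    and "\<And>i. i \<le> n \<Longrightarrow> y i \<in> {a..b}"
    and "\<And>i j. i \<le> j \<Longrightarrow> j \<le> n \<Longrightarrow> y i \<le> y j"
    and "\<And>i j. i + j \<le> n \<Longrightarrow> y i = y (i + j) \<Longrightarrow> e j (y i) = 0"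
  shows "\<exists>\<xi>\<in>{a..b}. e n \<xi> = 0"
  using assms
proof (induction n arbitrary: e y)
  case 0
  then show ?case by (intro bexI[of _ "y 0"]) auto
next
  case (Suc n)
  note C = Suc.prems(1) and range = Suc.prems(2) and mono = Suc.prems(3) and zero = Suc.prems(4)
  have "\<exists>z. y i \<le> z \<and> z \<le> y (Suc i) \<and> e 1 z = 0 \<and>
      (y i < y (Suc i) \<longrightarrow> y i < z \<and> z < y (Suc i))" if i: "i \<le> n" for i
  proof (cases "y i < y (Suc i)")
    case True
    have "{y i..y (Suc i)} \<subseteq> {a..b}"
      using range[of i] range[of "Suc i"] i by auto
    then have cont: "continuous_on {y i..y (Suc i)} (e 0)"
      using C unfolding Cr_on_def by (meson continuous_on_subset le0)
    have der: "DERIV (e 0) z :> e 1 z" if "y i < z" "z < y (Suc i)" for z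
    proof -
      have z: "z \<in> interior {a..b}"
        using that range[of i] range[of "Suc i"] i by auto
      then have "z \<in> {a..b}" using interior_subset by blast
      then have "(e 0 has_real_derivative e (Suc 0) z) (at z within {a..b})"
        using C unfolding Cr_on_def by blast
      then show ?thesis using at_within_interior[OF z] by simp
    qed
    have "e 0 (y i) = e 0 (y (Suc i))"
      using zero[of i 0] zero[of "Suc i" 0] i by simp
    then obtain z where z: "y i < z" "z < y (Suc i)" "DERIV (e 0) z :> 0"
      using Rolle[OF True _ cont] der real_differentiable_def by metis
    then have "e 1 z = 0" using der DERIV_unique by blast
    then show ?thesis using z by (intro exI[of _ z]) auto
  next
    case False
    then have "y i = y (Suc i)" using mono[of i "Suc i"] i by simp
    then show ?thesis using zero[of i 1] i by (intro exI[of _ "y i"]) auto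
  qed
  then obtain z where z: "\<And>i. i \<le> n \<Longrightarrow> y i \<le> z i" "\<And>i. i \<le> n \<Longrightarrow> z i \<le> y (Suc i)"
      "\<And>i. i \<le> n \<Longrightarrow> e 1 (z i) = 0"
      "\<And>i. i \<le> n \<Longrightarrow> y i < y (Suc i) \<Longrightarrow> y i < z i \<and> z i < y (Suc i)"
    by metis
  have "\<exists>\<xi>\<in>{a..b}. e (Suc n) \<xi> = 0"
  proof (rule Suc.IH[of "\<lambda>i. e (Suc i)" z])
    show "Cr_on n (\<lambda>i. e (Suc i)) a b"
      using C unfolding Cr_on_def by auto
    show "z i \<in> {a..b}" if "i \<le> n" for i
      using z(1)[OF that] z(2)[OF that] range[of i] range[of "Suc i"] that by auto
    show "z i \<le> z j" if "i \<le> j" "j \<le> n" for i j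
    proof (cases "i = j")
      case False
      then have "y (Suc i) \<le> y j" using that mono[of "Suc i" j] by simp
      then show ?thesis using z(2)[of i] z(1)[of j] that by linarith
    qed simp
    \<comment> \<open>For \<open>j > 0\<close> equal new points are squeezed onto nodes; as Rolle
      points are strictly interior, all nodes from \<open>i\<close> to \<open>i + j + 1\<close> must
      coincide, one more than at the new level.\<close>
    show "e (Suc j) (z i) = 0" if "i + j \<le> n" "z i = z (i + j)" for i j
    proof (cases "j = 0")
      case True
      then show ?thesis using z(3)[of i] that(1) by simp
    next
      case False
      have "y (Suc i) \<le> y (i + j)" using that False mono[of "Suc i" "i + j"] by simp
      then have eq: "z i = y (Suc i)" "z (i + j) = y (i + j)"
        using z(2)[of i] z(1)[of "i + j"] that by auto
      then have "\<not> y i < y (Suc i)" "\<not> y (i + j) < y (Suc (i + j))"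
        using z(4)[of i] z(4)[of "i + j"] that by auto
      then have "y i = y (Suc i)" "y (i + j) = y (Suc (i + j))"
        using mono[of i "Suc i"] mono[of "i + j" "Suc (i + j)"] that by auto
      then show ?thesis using zero[of i "Suc j"] eq that by simp
    qed
  qed
  then show ?case .
qed

section \<open>Hermite interpolation with coalescing nodes\<close>

lemma higher_pderiv_diff:
  "(pderiv ^^ n) (p - q) = (pderiv ^^ n) p - (pderiv ^^ n) (q :: real poly)"
  by (induction n) (simp_all add: pderiv_diff)

text \<open>Leibniz rule; at \<open>j = 0\<close> the truncated \<open>j - 1\<close> is multiplied
  by 0.\<close>

lemma higher_pderiv_mult_linear:
  fixes H :: "real poly"
  shows "poly ((pderiv ^^ j) ([:-a, 1:] * H)) z
    = (z - a) * poly ((pderiv ^^ j) H) z + real j * poly ((pderiv ^^ (j - 1)) H) z"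
proof (induction j arbitrary: H)
  case 0
  then show ?case by (simp add: algebra_simps)
next
  case (Suc j)
  have "pderiv ([:-a, 1:] * H) = [:-a, 1:] * pderiv H + H"
    by (simp add: pderiv_mult pderiv_pCons pderiv_diff pderiv_smult)
  then have "poly ((pderiv ^^ Suc j) ([:-a, 1:] * H)) z =
      poly ((pderiv ^^ j) ([:-a, 1:] * pderiv H)) z + poly ((pderiv ^^ j) H) z"
    by (simp only: funpow_Suc_right o_apply higher_pderiv_add poly_add)
  also have "\<dots> = (z - a) * poly ((pderiv ^^ Suc j) H) z
      + real j * poly ((pderiv ^^ (j - 1)) (pderiv H)) z + poly ((pderiv ^^ j) H) z"
    unfolding Suc.IH by (simp add: funpow_swap1)
  also have "real j * poly ((pderiv ^^ (j - 1)) (pderiv H)) z = real j * poly ((pderiv ^^ j) H) z"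
    by (cases j) (simp_all add: funpow_swap1)
  finally show ?case by (simp add: algebra_simps)
qed

text \<open>At \<open>a\<close> the \<open>j\<close>-th derivative of \<open>(x - a) T\<close> is
  \<open>j\<close> times the one of \<open>T\<close> of order \<open>j - 1\<close>, hence the data
  \<open>d (Suc j) / Suc j\<close> in the Horner step.\<close>

lemma poly_taylor_derivs:
  fixes d :: "nat \<Rightarrow> real"
  shows "\<exists>T. degree T \<le> n \<and> coeff T n = d n / fact n \<and> (\<forall>j\<le>n. poly ((pderiv ^^ j) T) a = d j)"
proof (induction n arbitrary: d)
  case 0
  show ?case by (rule exI[of _ "[:d 0:]"]) simp
next
  case (Suc n)
  obtain T where T: "degree T \<le> n" "coeff T n = d (Suc n) / fact (Suc n)"
      "\<forall>j\<le>n. poly ((pderiv ^^ j) T) a = d (Suc j) / real (Suc j)"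
    using Suc.IH[of "\<lambda>j. d (Suc j) / real (Suc j)"] by (auto simp: field_simps)
  define T' where "T' = [:d 0:] + [:-a, 1:] * T"
  have "degree T' \<le> Suc n"
    unfolding T'_def by (rule degree_add_le) (use T(1) degree_mult_le[of "[:-a, 1:]" T] in auto)
  moreover have "coeff T' (Suc n) = d (Suc n) / fact (Suc n)"
    using T by (simp add: T'_def coeff_eq_0)
  moreover have "poly ((pderiv ^^ j) T') a = d j" if "j \<le> Suc n" for j
  proof (cases j)
    case 0
    then show ?thesis by (simp add: T'_def)
  next
    case (Suc i)
    have "(pderiv ^^ j) [:d 0:] = 0" unfolding Suc by (simp add: funpow_swap1 pderiv_pCons)
    then show ?thesis
      unfolding T'_def higher_pderiv_add poly_add higher_pderiv_mult_linear
      using T(3) that Suc by simp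
  qed
  ultimately show ?case by blast
qed

text \<open>Identifies the recursively defined divided difference with a leading coefficient, the
  form in which the mean value theorem can be reached.\<close>

lemma hermite_interpolant:
  assumes "p \<le> q" "\<And>i j. p \<le> i \<Longrightarrow> i \<le> j \<Longrightarrow> j \<le> q \<Longrightarrow> x i \<le> x j"
  shows "\<exists>H. degree H \<le> q - p \<and> coeff H (q - p) = dd D x p q \<and>
    (\<forall>i j. p \<le> i \<longrightarrow> i + j \<le> q \<longrightarrow> x i = x (i + j) \<longrightarrow> poly ((pderiv ^^ j) H) (x i) = D j (x i))"
  using assms
proof (induction "q - p" arbitrary: p q rule: less_induct)
  case less
  note mono = less.prems(2)
  show ?case
  proof (cases "x p < x q")
    case False
    have eq: "x i = x p" if "p \<le> i" "i \<le> q" for i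
      using mono[of p i] mono[of i q] that False by force
    obtain T where T: "degree T \<le> q - p" "coeff T (q - p) = D (q - p) (x p) / fact (q - p)"
      "\<forall>j\<le>q-p. poly ((pderiv ^^ j) T) (x p) = D j (x p)"
      using poly_taylor_derivs[of "q - p" "\<lambda>j. D j (x p)" "x p"] by blast
    have "dd D x p q = D (q - p) (x p) / fact (q - p)"
      using less.prems(1) eq by (rule dd_const)
    moreover have "poly ((pderiv ^^ j) T) (x i) = D j (x i)" if "p \<le> i" "i + j \<le> q" for i j
      using T(3) eq[of i] that by simp
    ultimately show ?thesis
      using T(1,2) by (intro exI[of _ T] conjI allI impI) metis+
  next
    case True
    then have pq: "p < q" using less.prems(1) by (cases "p = q") auto
    obtain n where n: "q - p = Suc n" "q - Suc p = n" "q - 1 - p = n"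
      using pq by (metis Suc_diff_Suc diff_Suc_1 diff_commute)
    have "\<exists>R. degree R \<le> q - Suc p \<and> coeff R (q - Suc p) = dd D x (Suc p) q \<and>
      (\<forall>i j. Suc p \<le> i \<longrightarrow> i + j \<le> q \<longrightarrow> x i = x (i + j) \<longrightarrow> poly ((pderiv ^^ j) R) (x i) = D j (x i))"
      by (rule less.hyps) (use pq mono in auto)
    then obtain R where R: "degree R \<le> n" "coeff R n = dd D x (Suc p) q"
      "\<And>i j. Suc p \<le> i \<Longrightarrow> i + j \<le> q \<Longrightarrow> x i = x (i + j) \<Longrightarrow> poly ((pderiv ^^ j) R) (x i) = D j (x i)"
      unfolding n by metis
    have "\<exists>L. degree L \<le> q - 1 - p \<and> coeff L (q - 1 - p) = dd D x p (q - 1) \<and>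
      (\<forall>i j. p \<le> i \<longrightarrow> i + j \<le> q - 1 \<longrightarrow> x i = x (i + j) \<longrightarrow> poly ((pderiv ^^ j) L) (x i) = D j (x i))"
      by (rule less.hyps) (use pq mono in auto)
    then obtain L where L: "degree L \<le> n" "coeff L n = dd D x p (q - 1)"
      "\<And>i j. p \<le> i \<Longrightarrow> i + j \<le> q - 1 \<Longrightarrow> x i = x (i + j) \<Longrightarrow> poly ((pderiv ^^ j) L) (x i) = D j (x i)"
      unfolding n by metis
    define h where "h = x q - x p"
    have h: "h > 0" using True by (simp add: h_def)
    \<comment> \<open>Aitken-Neville step: \<open>R\<close> omits the first node and
      \<open>L\<close> the last, and each is multiplied by the linear factor that vanishes at the
      node it omits.\<close>
    define H where "H = smult (1 / h) ([:-x p, 1:] * R - [:-x q, 1:] * L)"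
    have "degree H \<le> Suc n"
      unfolding H_def using R(1) L(1) degree_mult_le[of "[:-x p, 1:]" R] degree_mult_le[of "[:-x q, 1:]" L]
      by (intro order.trans[OF degree_smult_le] degree_diff_le) auto
    moreover have "coeff H (Suc n) = dd D x p q"
      using R L unfolding dd_rec[OF pq True] R(2)[symmetric] L(2)[symmetric]
      by (simp add: H_def h_def coeff_eq_0 field_simps)
    moreover have "poly ((pderiv ^^ j) H) (x i) = D j (x i)"
      if i: "p \<le> i" "i + j \<le> q" "x i = x (i + j)" for i j
    proof -
      define z where "z = x i"
      have "h * poly ((pderiv ^^ j) H) z
          = (z - x p) * poly ((pderiv ^^ j) R) z + real j * poly ((pderiv ^^ (j - 1)) R) z
          - ((z - x q) * poly ((pderiv ^^ j) L) z + real j * poly ((pderiv ^^ (j - 1)) L) z)"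
        using h unfolding H_def higher_pderiv_smult higher_pderiv_diff poly_smult poly_diff
          higher_pderiv_mult_linear by simp
      also have "(z - x p) * poly ((pderiv ^^ j) R) z = (z - x p) * D j z"
        using R(3)[of i j] i by (cases "i = p") (auto simp: z_def)
      also have "(z - x q) * poly ((pderiv ^^ j) L) z = (z - x q) * D j z"
        using L(3)[of i j] i by (cases "i + j = q") (auto simp: z_def)
      \<comment> \<open>Of the equal nodes \<open>i\<close> to \<open>i + j\<close>,
        \<open>j\<close> remain after one is dropped at either end, so \<open>R\<close> and
        \<open>L\<close> both match order \<open>j - 1\<close> and these two terms cancel.\<close>
      also have "real j * poly ((pderiv ^^ (j - 1)) R) z = real j * D (j - 1) z"
      proof (cases "j = 0")
        case False
        have "x (Suc i) = x i"
          using mono[of i "Suc i"] mono[of "Suc i" "i + j"] i False by auto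
        then show ?thesis using R(3)[of "Suc i" "j - 1"] i False by (auto simp: z_def)
      qed simp
      also have "real j * poly ((pderiv ^^ (j - 1)) L) z = real j * D (j - 1) z"
      proof (cases "j = 0")
        case False
        have "x (i + (j - 1)) = x i"
          using mono[of i "i + (j - 1)"] mono[of "i + (j - 1)" "i + j"] i False by force
        then show ?thesis using L(3)[of i "j - 1"] i False by (auto simp: z_def)
      qed simp
      finally have "h * poly ((pderiv ^^ j) H) z = h * D j z"
        by (simp add: h_def algebra_simps)
      then show ?thesis using h by (simp add: z_def)
    qed
    ultimately show ?thesis unfolding n by blast
  qed
qed

text \<open>Generalized Rolle for \<open>D\<close> minus its interpolant: the derivatives of order
  \<open>q - p\<close> meet somewhere, and that of the interpolant is a factorial times its leading
  coefficient.\<close>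

theorem dd_mvt:
  assumes "p \<le> q" "\<And>i j. p \<le> i \<Longrightarrow> i \<le> j \<Longrightarrow> j \<le> q \<Longrightarrow> x i \<le> x j"
    and C: "Cr_on (q - p) D (x p) (x q)"
  shows "\<exists>\<xi>\<in>{x p..x q}. dd D x p q = D (q - p) \<xi> / fact (q - p)"
proof -
  define n where "n = q - p"
  obtain H where H: "degree H \<le> n" "coeff H n = dd D x p q"
    "\<And>i j. p \<le> i \<Longrightarrow> i + j \<le> q \<Longrightarrow> x i = x (i + j) \<Longrightarrow> poly ((pderiv ^^ j) H) (x i) = D j (x i)"
    using hermite_interpolant[of p q x D, OF assms(1,2)] unfolding n_def by blast
  define e where "e i y = D i y - poly ((pderiv ^^ i) H) y" for i y
  have "\<exists>\<xi>\<in>{x p..x q}. e n \<xi> = 0"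
  proof (rule generalized_rolle[of n e _ _ "\<lambda>i. x (p + i)"])
    show "Cr_on n e (x p) (x q)"
      using Cr_on_diff[OF C Cr_on_poly[of _ H]] unfolding e_def n_def .
    show "e j (x (p + i)) = 0" if "i + j \<le> n" "x (p + i) = x (p + (i + j))" for i j
      using H(3)[of "p + i" j] that assms(1) by (simp add: e_def n_def add.assoc)
  qed (use assms(1,2) in \<open>auto simp: n_def\<close>)
  then obtain \<xi> where xi: "\<xi> \<in> {x p..x q}" "D n \<xi> = poly ((pderiv ^^ n) H) \<xi>"
    by (auto simp: e_def)
  have "(pderiv ^^ n) H = [:fact n * coeff H n:]"
  proof (rule poly_eqI)
    fix i show "coeff ((pderiv ^^ n) H) i = coeff [:fact n * coeff H n:] i"
      using H(1) by (cases i) (simp_all add: coeff_higher_pderiv coeff_eq_0 pochhammer_fact)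
  qed
  then show ?thesis
    using xi H(2) unfolding n_def by (intro bexI[of _ \<xi>]) (simp_all del: upt_Suc)
qed

subsection \<open>The modulus of smoothness\<close>

lemma sym_diff_eq_fdiff:
  assumes "a \<le> y" "y + real k * u \<le> b"
  shows "\<bar>sym_diff k g u a b (y + real k / 2 * u)\<bar> = \<bar>fdiff k u g y\<bar>"
proof -
  have "(\<Sum>i\<le>k. (-1) ^ i * real (k choose i) * g (y + real k / 2 * u + (real k / 2 - real i) * u))
      = (\<Sum>i\<le>k. (-1) ^ (k - i) * real (k choose (k - i)) * g (y + real k / 2 * u + (real k / 2 - real (k - i)) * u))"
    by (rule sum.reindex_bij_witness[of _ "\<lambda>i. k - i" "\<lambda>i. k - i"]) auto
  also have "\<dots> = (\<Sum>i\<le>k. (-1) ^ k * ((-1) ^ i * real (k choose i) * g (y + real i * u)))"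
  proof (rule sum.cong)
    fix i assume i: "i \<in> {..k}"
    have e1: "(-1) ^ (k - i) = (-1 :: real) ^ k * (-1) ^ i"
      using i by (auto simp: uminus_power_if)
    have e2: "k choose (k - i) = k choose i"
      using i binomial_symmetric[of i k] by simp
    have e3: "y + real k / 2 * u + (real k / 2 - real (k - i)) * u = y + real i * u"
      using i by (simp add: of_nat_diff algebra_simps)
    show "(-1) ^ (k - i) * real (k choose (k - i)) * g (y + real k / 2 * u + (real k / 2 - real (k - i)) * u)
        = (-1) ^ k * ((-1) ^ i * real (k choose i) * g (y + real i * u))"
      unfolding e1 e2 e3 by (simp only: mult.assoc)
  qed simp
  also have "\<dots> = fdiff k u g y"
    by (simp add: fdiff_eq_sum sum_distrib_left)
  finally show ?thesis
    using assms by (simp add: sym_diff_def algebra_simps)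
qed

text \<open>The suprema in \<open>modsmooth\<close> are informative only over bounded sets; this
  bound, uniform in step and point, ensures that.\<close>

lemma sym_diff_bounded:
  assumes "continuous_on {a..b} g"
  shows "\<exists>B. \<forall>u\<ge>0. \<forall>x. \<bar>sym_diff k g u a b x\<bar> \<le> B"
proof -
  have "compact (g ` {a..b})" using assms by (intro compact_continuous_image) auto
  then have "bounded (g ` {a..b})" by (rule compact_imp_bounded)
  then obtain M where M: "M > 0" "\<And>x. x \<in> {a..b} \<Longrightarrow> \<bar>g x\<bar> \<le> M"
    by (auto simp: bounded_pos)
  show ?thesis
  proof (intro exI[of _ "\<Sum>i\<le>k. real (k choose i) * M"] allI impI)
    fix u x :: real assume u: "0 \<le> u"
    show "\<bar>sym_diff k g u a b x\<bar> \<le> (\<Sum>i\<le>k. real (k choose i) * M)"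
    proof (cases "a \<le> x - real k / 2 * u \<and> x + real k / 2 * u \<le> b")
      case True
      have "\<bar>\<Sum>i\<le>k. (-1) ^ i * real (k choose i) * g (x + (real k / 2 - real i) * u)\<bar>
          \<le> (\<Sum>i\<le>k. real (k choose i) * M)"
      proof (rule order.trans[OF sum_abs], rule sum_mono)
        fix i assume i: "i \<in> {..k}"
        have "- (real k / 2) * u \<le> (real k / 2 - real i) * u" "(real k / 2 - real i) * u \<le> real k / 2 * u"
          using i u by (intro mult_right_mono; simp)+
        then have "\<bar>g (x + (real k / 2 - real i) * u)\<bar> \<le> M" using True by (intro M(2)) auto
        then show "\<bar>(-1) ^ i * real (k choose i) * g (x + (real k / 2 - real i) * u)\<bar> \<le> real (k choose i) * M"
          by (simp add: abs_mult power_abs mult_left_mono)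
      qed
      then show ?thesis using True by (simp add: sym_diff_def)
    next
      case False
      then show ?thesis using M(1) by (auto simp: sym_diff_def intro!: sum_nonneg)
    qed
  qed
qed

lemma modsmooth_facts:
  assumes "a \<le> b" and "continuous_on {a..b} g"
  shows sym_diff_le_modsmooth:
      "0 < u \<Longrightarrow> u \<le> t \<Longrightarrow> y \<in> {a..b} \<Longrightarrow> \<bar>sym_diff k g u a b y\<bar> \<le> modsmooth k g a b t"
    and modsmooth_nonneg: "0 < t \<Longrightarrow> 0 \<le> modsmooth k g a b t"
    and modsmooth_mono: "0 < s \<Longrightarrow> s \<le> t \<Longrightarrow> modsmooth k g a b s \<le> modsmooth k g a b t"
proof -
  obtain B where B: "\<And>u x. 0 \<le> u \<Longrightarrow> \<bar>sym_diff k g u a b x\<bar> \<le> B"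
    using sym_diff_bounded[OF assms(2)] by blast
  define S where "S u = (SUP x\<in>{a..b}. \<bar>sym_diff k g u a b x\<bar>)" for u
  have bdd1: "bdd_above ((\<lambda>x. \<bar>sym_diff k g u a b x\<bar>) ` {a..b})" if "0 < u" for u
    using B that by (intro bdd_aboveI2[of _ _ B]) auto
  have "S u \<le> B" if "0 < u" for u
    unfolding S_def using assms B that by (intro cSUP_least) auto
  then have bdd2: "bdd_above (S ` {0<..t})" for t
    by (intro bdd_aboveI2[of _ _ B]) auto
  have mod: "modsmooth k g a b t = (SUP u\<in>{0<..t}. S u)" for t
    by (simp add: modsmooth_def S_def)
  show *: "\<bar>sym_diff k g u a b y\<bar> \<le> modsmooth k g a b t" if "0 < u" "u \<le> t" "y \<in> {a..b}" for u t y
  proof -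
    have "\<bar>sym_diff k g u a b y\<bar> \<le> S u" unfolding S_def by (intro cSUP_upper bdd1 that)
    also have "\<dots> \<le> modsmooth k g a b t" unfolding mod by (intro cSUP_upper bdd2) (use that in auto)
    finally show ?thesis .
  qed
  show "0 \<le> modsmooth k g a b t" if "0 < t"
    using *[of t t a] that assms(1) by auto
  show "modsmooth k g a b s \<le> modsmooth k g a b t" if "0 < s" "s \<le> t"
    unfolding mod by (intro cSUP_subset_mono bdd2) (use that in auto)
qed

subsection \<open>Clusters of nodes\<close>

text \<open>\<open>wt m x p q u\<close> is the denominator of \<open>Lambda_pq\<close> with every factor truncated from below at the
  scale \<open>u\<close>; for \<open>x q - x p \<le> u\<close> it bounds from below the product of the denominators met when passing
  from \<open>[x 0, \<dots>, x m]\<close> to \<open>[x p, \<dots>, x q]\<close> by discarding end points of intervals longer than \<open>u\<close>.\<close>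

definition wt :: "nat \<Rightarrow> (nat \<Rightarrow> real) \<Rightarrow> nat \<Rightarrow> nat \<Rightarrow> real \<Rightarrow> real" where
  "wt m x p q u = (\<Prod>i<p. max (x q - x i) u) * (\<Prod>i\<in>{Suc q..m}. max (x i - x p) u)"

text \<open>\<open>gap m x p q\<close> is the upper integration limit \<open>d(p, q)\<close>: the scale at which the cluster
  \<open>x p, \<dots>, x q\<close> absorbs a neighbouring node.\<close>

definition gap :: "nat \<Rightarrow> (nat \<Rightarrow> real) \<Rightarrow> nat \<Rightarrow> nat \<Rightarrow> real" where
  "gap m x p q = min ((if q = m then x m + (x m - x 0) else x (Suc q)) - x p)
     (x q - (if p = 0 then x 0 - (x m - x 0) else x (p - 1)))"

lemma wt_nonneg: "0 \<le> u \<Longrightarrow> 0 \<le> wt m x p q u"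
  unfolding wt_def by (intro mult_nonneg_nonneg prod_nonneg) auto

lemma wt_full: "wt m x 0 m u = 1"
  by (simp add: wt_def)

lemma wt_mono: "0 \<le> u \<Longrightarrow> u \<le> v \<Longrightarrow> wt m x p q u \<le> wt m x p q v"
  unfolding wt_def by (intro mult_mono prod_mono prod_nonneg) (auto simp: max_def)

lemma wt_double:
  assumes "0 \<le> u" "p \<le> q" "q \<le> m"
  shows "wt m x p q (2 * u) \<le> 2 ^ m * wt m x p q u"
proof -
  have "wt m x p q (2 * u) \<le> (\<Prod>i<p. 2 * max (x q - x i) u) * (\<Prod>i\<in>{Suc q..m}. 2 * max (x i - x p) u)"
    unfolding wt_def using assms by (intro mult_mono prod_mono prod_nonneg) (auto simp: max_def)
  also have "\<dots> = 2 ^ (p + (m - q)) * wt m x p q u"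
    by (simp add: wt_def prod.distrib power_add)
  also have "\<dots> \<le> 2 ^ m * wt m x p q u"
    using assms by (intro mult_right_mono wt_nonneg power_increasing) auto
  finally show ?thesis .
qed

lemma wt_ge_power:
  assumes "0 \<le> u" "p \<le> q" "q \<le> m"
  shows "u ^ (m - (q - p)) \<le> wt m x p q u"
proof -
  have "m - (q - p) = p + (m - q)" using assms by simp
  then have "u ^ (m - (q - p)) = (\<Prod>i<p. u) * (\<Prod>i\<in>{Suc q..m}. u)"
    by (simp add: power_add)
  also have "\<dots> \<le> wt m x p q u"
    unfolding wt_def using assms by (intro mult_mono prod_mono prod_nonneg) auto
  finally show ?thesis .
qed

text \<open>Only positive arguments of \<open>\<phi>\<close> are constrained: at 0 the modulus is a
  supremum over the empty set.\<close>

locale nodes =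
  fixes m r :: nat and x :: "nat \<Rightarrow> real" and \<phi> :: "real \<Rightarrow> real"
  assumes r_less: "r < m"
    and x_mono: "\<And>i j. i \<le> j \<Longrightarrow> j \<le> m \<Longrightarrow> x i \<le> x j"
    and x_sep: "\<And>j. j + r + 1 \<le> m \<Longrightarrow> x j < x (j + r + 1)"
    and phi_nonneg: "\<And>u. 0 < u \<Longrightarrow> 0 \<le> \<phi> u"
    and phi_mono: "\<And>u v. 0 < u \<Longrightarrow> u \<le> v \<Longrightarrow> \<phi> u \<le> \<phi> v"
begin

section \<open>Kernel integrals and the functional \<open>Lambda\<close>\<close>

abbreviation W where "W \<equiv> wt m x"
abbreviation L where "L \<equiv> Lambda r m x \<phi>"
abbreviation H where "H \<equiv> x m - x 0"

text \<open>With \<open>s = q - p - r\<close> the exponent \<open>p + r - q - 1\<close> is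
  \<open>-(s + 1)\<close>; \<open>s\<close> counts the derivatives taken beyond the
  \<open>r\<close>-th.\<close>

definition I :: "nat \<Rightarrow> real \<Rightarrow> real \<Rightarrow> real" where
  "I s A B = integral {A..B} (\<lambda>u. \<phi> u / u ^ Suc s)"

lemma x_less: "p + r + 1 \<le> q \<Longrightarrow> q \<le> m \<Longrightarrow> x p < x q"
  using x_sep[of p] x_mono[of "p + r + 1" q] by simp

lemma H_pos: "0 < H"
  using x_less[of 0 m] r_less by simp

lemma width_le: "p \<le> q \<Longrightarrow> q \<le> m \<Longrightarrow> x q - x p \<le> H"
  using x_mono[of 0 p] x_mono[of q m] by simp

text \<open>\<open>\<phi>\<close> is known to be monotone but not continuous, so integrability rests
  on measurability and boundedness.\<close>

lemma kernel_integrable: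
  assumes "0 < A"
  shows "(\<lambda>u. \<phi> u / u ^ Suc s) integrable_on {A..B}"
proof -
  have "mono_on {A..B} \<phi>"
    using assms by (intro mono_onI phi_mono) auto
  then have meas: "\<phi> \<in> borel_measurable (lebesgue_on {A..B})"
    by (intro borel_measurable_integrable integrable_mono_on)
  have "\<phi> ` {A..B} \<subseteq> {\<phi> A..\<phi> B}"
    using assms by (auto intro!: phi_mono)
  then have bou: "bounded (\<phi> ` {A..B})"
    by (rule bounded_subset[rotated]) simp
  have "(\<lambda>u. 1 / u ^ Suc s) absolutely_integrable_on {A..B}"
    using assms by (intro absolutely_integrable_continuous_real continuous_intros) auto
  from absolutely_integrable_bounded_measurable_product_real[OF meas _ bou this]
  have "(\<lambda>u. \<phi> u * (1 / u ^ Suc s)) absolutely_integrable_on {A..B}" by simp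
  then show ?thesis
    by (simp add: set_lebesgue_integral_eq_integral(1))
qed

lemma kernel_nonneg: "0 < u \<Longrightarrow> 0 \<le> \<phi> u / u ^ Suc s"
  by (simp add: phi_nonneg)

lemma I_nonneg: "0 < A \<Longrightarrow> 0 \<le> I s A B"
  unfolding I_def by (intro integral_nonneg kernel_integrable) (auto simp del: power_Suc intro!: kernel_nonneg)

lemma I_subset: "0 < A' \<Longrightarrow> A' \<le> A \<Longrightarrow> B \<le> B' \<Longrightarrow> I s A B \<le> I s A' B'"
  unfolding I_def by (intro integral_subset_le kernel_integrable) (auto simp del: power_Suc intro!: kernel_nonneg)

lemma I_split: "0 < A \<Longrightarrow> A \<le> B \<Longrightarrow> B \<le> B' \<Longrightarrow> I s A B' = I s A B + I s B B'"
  unfolding I_def by (rule Henstock_Kurzweil_Integration.integral_combine[symmetric])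
    (auto intro: kernel_integrable simp del: power_Suc)

lemma I_raise:
  assumes "0 < A"
  shows "I s A B \<le> B * I (Suc s) A B"
proof -
  have "I s A B \<le> integral {A..B} (\<lambda>u. B * (\<phi> u / u ^ Suc (Suc s)))"
    unfolding I_def
  proof (intro integral_le kernel_integrable integrable_on_mult_right assms)
    fix u assume u: "u \<in> {A..B}"
    then have "0 < u" using assms by auto
    then have "\<phi> u / u ^ Suc s = u * (\<phi> u / u ^ Suc (Suc s))" by simp
    also have "\<dots> \<le> B * (\<phi> u / u ^ Suc (Suc s))"
      using u \<open>0 < u\<close> by (intro mult_right_mono kernel_nonneg) auto
    finally show "\<phi> u / u ^ Suc s \<le> B * (\<phi> u / u ^ Suc (Suc s))" .
  qed
  then show ?thesis unfolding I_def by (simp only: integral_mult_right)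
qed

text \<open>Monotonicity turns a point value into an integral over one doubling; the powers of 2
  come from bounding \<open>u\<close> by \<open>2 * A\<close> in the kernel.\<close>

lemma phi_le_I:
  assumes "0 < A"
  shows "\<phi> A / A ^ s \<le> 2 ^ Suc s * I s A (2 * A)"
proof -
  have "A * (\<phi> A / (2 * A) ^ Suc s) = integral {A..2 * A} (\<lambda>u. \<phi> A / (2 * A) ^ Suc s)"
    using assms by simp
  also have "\<dots> \<le> I s A (2 * A)"
    unfolding I_def
  proof (intro integral_le kernel_integrable assms integrable_const_ivl)
    fix u assume u: "u \<in> {A..2 * A}"
    then have "0 < u" using assms by auto
    then show "\<phi> A / (2 * A) ^ Suc s \<le> \<phi> u / u ^ Suc s"
      using u assms by (intro frac_le power_mono phi_nonneg phi_mono) auto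
  qed
  finally show ?thesis using assms by (simp add: power_mult_distrib field_simps)
qed

text \<open>At the scale \<open>x q - x p\<close> no factor of the weight is truncated.\<close>

lemma Lambda_pq_eq:
  assumes "p + r + 1 \<le> q" "q \<le> m"
  shows "Lambda_pq p q r m x \<phi> = I (q - p - r) (x q - x p) (gap m x p q) / W p q (x q - x p)"
proof -
  define s where "s = q - p - r"
  have e: "int p + int r - int q - 1 = - int (Suc s)"
    using assms by (simp add: s_def)
  have "(\<lambda>u. u powi (int p + int r - int q - 1) * \<phi> u) = (\<lambda>u. \<phi> u / u ^ Suc s)"
    unfolding e power_int_minus power_int_of_nat by (simp add: divide_inverse mult.commute)
  moreover have "(\<Prod>i<p. x q - x i) = (\<Prod>i<p. max (x q - x i) (x q - x p))"
    using assms x_mono[of _ p] by (intro prod.cong refl max_absorb1[symmetric]) auto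
  moreover have "(\<Prod>i\<in>{Suc q..m}. x i - x p) = (\<Prod>i\<in>{Suc q..m}. max (x i - x p) (x q - x p))"
    using assms x_mono[of q] by (intro prod.cong refl max_absorb1[symmetric]) auto
  ultimately show ?thesis
    unfolding Lambda_pq_def I_def wt_def gap_def Let_def s_def[symmetric] by simp
qed

lemma Lambda_pq_le:
  assumes "p + r + 1 \<le> q" "q \<le> m"
  shows "Lambda_pq p q r m x \<phi> \<le> L"
  unfolding Lambda_def
proof (rule Max_ge)
  have "{Lambda_pq p q r m x \<phi> | p q. p \<le> m \<and> q \<le> m \<and> p + r + 1 \<le> q}
      \<subseteq> (\<lambda>(p, q). Lambda_pq p q r m x \<phi>) ` ({..m} \<times> {..m})"
    by auto
  then show "finite {Lambda_pq p q r m x \<phi> | p q. p \<le> m \<and> q \<le> m \<and> p + r + 1 \<le> q}"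
    by (rule finite_subset) simp
  show "Lambda_pq p q r m x \<phi> \<in> {Lambda_pq p q r m x \<phi> | p q. p \<le> m \<and> q \<le> m \<and> p + r + 1 \<le> q}"
    by (rule CollectI, rule exI[of _ p], rule exI[of _ q]) (use assms in auto)
qed

lemma I_gap_le:
  assumes "p + r + 1 \<le> q" "q \<le> m"
  shows "I (q - p - r) (x q - x p) (gap m x p q) \<le> L * W p q (x q - x p)"
proof -
  have pos: "0 < x q - x p" using x_less assms by simp
  then have "0 < (x q - x p) ^ (m - (q - p))" by simp
  also have "\<dots> \<le> W p q (x q - x p)" using pos assms by (intro wt_ge_power) auto
  finally have "0 < W p q (x q - x p)" .
  then show ?thesis
    using Lambda_pq_le[OF assms] unfolding Lambda_pq_eq[OF assms] by (simp add: field_simps)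
qed

text \<open>The artificial nodes put the gap of the full cluster at \<open>2 * H\<close>; all other
  gaps are at most \<open>H\<close>, so this is the only access to larger scales.\<close>

lemma I_full_le: "I (m - r) H (2 * H) \<le> L"
proof -
  have "gap m x 0 m = 2 * H" by (simp add: gap_def)
  then show ?thesis
    using I_gap_le[of 0 m] r_less by (simp add: wt_full)
qed

lemma L_nonneg: "0 \<le> L"
  using I_nonneg[of H "m - r" "2 * H"] I_full_le H_pos by linarith

text \<open>The factor of the absorbed node is truncated to \<open>u\<close> and drops out.
  Replacing \<open>x q\<close> by \<open>x (Suc q)\<close> moves the end by at most
  \<open>u\<close>, so every factor on the left at most doubles.\<close>

lemma wt_extend_right:
  assumes "p \<le> q" "q < m" "x (Suc q) - x p \<le> u" "0 < u"
  shows "W p (Suc q) u * u \<le> 2 ^ m * W p q u"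
proof -
  define R where "R = (\<Prod>i\<in>{Suc (Suc q)..m}. max (x i - x p) u)"
  have R: "0 \<le> R" unfolding R_def using assms by (intro prod_nonneg) auto
  have "(\<Prod>i<p. max (x (Suc q) - x i) u) \<le> (\<Prod>i<p. 2 * max (x q - x i) u)"
  proof (intro prod_mono conjI)
    fix i assume "i \<in> {..<p}"
    then show "max (x (Suc q) - x i) u \<le> 2 * max (x q - x i) u"
      using x_mono[of p q] assms by (auto simp: max_def)
  qed (use assms in auto)
  also have "\<dots> = 2 ^ p * (\<Prod>i<p. max (x q - x i) u)"
    by (simp add: prod.distrib)
  also have "\<dots> \<le> 2 ^ m * (\<Prod>i<p. max (x q - x i) u)"
    using assms by (intro mult_right_mono power_increasing prod_nonneg) auto
  finally have "(\<Prod>i<p. max (x (Suc q) - x i) u) * (R * u) \<le> 2 ^ m * (\<Prod>i<p. max (x q - x i) u) * (R * u)"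
    using R assms by (intro mult_right_mono) auto
  moreover have "(\<Prod>i\<in>{Suc q..m}. max (x i - x p) u) = u * R"
    using assms by (subst prod.atLeast_Suc_atMost) (auto simp: R_def max_def)
  ultimately show ?thesis
    unfolding wt_def R_def[symmetric] by (simp add: mult_ac)
qed

lemma wt_extend_left:
  assumes "Suc p \<le> q" "q \<le> m" "x q - x p \<le> u" "0 < u"
  shows "W p q u * u \<le> 2 ^ m * W (Suc p) q u"
proof -
  define R where "R = (\<Prod>i<p. max (x q - x i) u)"
  have R: "0 \<le> R" unfolding R_def using assms by (intro prod_nonneg) auto
  have "(\<Prod>i\<in>{Suc q..m}. max (x i - x p) u) \<le> (\<Prod>i\<in>{Suc q..m}. 2 * max (x i - x (Suc p)) u)"
  proof (intro prod_mono conjI)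
    fix i assume "i \<in> {Suc q..m}"
    then show "max (x i - x p) u \<le> 2 * max (x i - x (Suc p)) u"
      using x_mono[of "Suc p" q] assms by (auto simp: max_def)
  qed (use assms in auto)
  also have "\<dots> = 2 ^ (m - q) * (\<Prod>i\<in>{Suc q..m}. max (x i - x (Suc p)) u)"
    by (simp add: prod.distrib)
  also have "\<dots> \<le> 2 ^ m * (\<Prod>i\<in>{Suc q..m}. max (x i - x (Suc p)) u)"
    using assms by (intro mult_right_mono power_increasing prod_nonneg) auto
  finally have "(\<Prod>i\<in>{Suc q..m}. max (x i - x p) u) * (R * u)
      \<le> 2 ^ m * (\<Prod>i\<in>{Suc q..m}. max (x i - x (Suc p)) u) * (R * u)"
    using R assms by (intro mult_right_mono) auto
  moreover have "(\<Prod>i<Suc p. max (x q - x i) u) = R * u"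
    using assms by (simp add: R_def max_def)
  ultimately show ?thesis
    unfolding wt_def R_def[symmetric] by (simp add: mult_ac)
qed

section \<open>Enlarging clusters across their gaps\<close>

lemma gap_le_right: "p \<le> q \<Longrightarrow> q < m \<Longrightarrow> gap m x p q \<le> x (Suc q) - x p"
  by (simp add: gap_def)

lemma gap_le_left: "0 < p \<Longrightarrow> gap m x p q \<le> x q - x (p - 1)"
  by (simp add: gap_def)

text \<open>Every untruncated factor is at least the gap, so at the gap the weight has its least
  value; this allows a return to a smaller scale.\<close>

lemma wt_gap_le:
  assumes "p \<le> q" "q \<le> m" "0 \<le> u"
  shows "W p q (gap m x p q) \<le> W p q u"
proof -
  have "gap m x p q \<le> x q - x i" if "i < p" for i
  proof -
    have "x i \<le> x (p - 1)" using that assms by (intro x_mono) auto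
    then show ?thesis using gap_le_left[of p q] that by linarith
  qed
  then have 1: "(\<Prod>i<p. max (x q - x i) (gap m x p q)) = (\<Prod>i<p. x q - x i)"
    by (intro prod.cong refl max_absorb1) auto
  have "gap m x p q \<le> x i - x p" if "i \<in> {Suc q..m}" for i
  proof -
    have "x (Suc q) \<le> x i" using that by (intro x_mono) auto
    then show ?thesis using gap_le_right[of p q] that assms by auto
  qed
  then have 2: "(\<Prod>i\<in>{Suc q..m}. max (x i - x p) (gap m x p q)) = (\<Prod>i\<in>{Suc q..m}. x i - x p)"
    by (intro prod.cong refl max_absorb1) auto
  show ?thesis
    unfolding wt_def 1 2 using assms x_mono
    by (intro mult_mono prod_mono prod_nonneg) auto
qed

text \<open>An artificial node lies a whole \<open>H\<close> beyond the end, so for a cluster that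
  is not full some genuine neighbour attains the minimum and can be absorbed.\<close>

lemma gap_extend:
  assumes "p \<le> q" "q \<le> m" "\<not> (p = 0 \<and> q = m)"
  shows "\<exists>p' q'. p' \<le> q' \<and> q' \<le> m \<and> q' - p' = Suc (q - p) \<and> x q' - x p' = gap m x p q \<and>
    (\<forall>u\<ge>gap m x p q. 0 < u \<longrightarrow> W p' q' u * u \<le> 2 ^ m * W p q u)"
proof -
  consider "q < m" "gap m x p q = x (Suc q) - x p" | "0 < p" "gap m x p q = x q - x (p - 1)"
  proof (cases "q = m")
    case True
    then have "0 < p" using assms by auto
    then have "x 0 \<le> x (p - 1)" "x p \<le> x m" using x_mono[of 0 "p - 1"] x_mono[of p m] assms by auto
    then show ?thesis using that True \<open>0 < p\<close> by (simp add: gap_def min_def)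
  next
    case False
    then have "q < m" using assms by simp
    then have "x 0 \<le> x q" "x (Suc q) \<le> x m" using x_mono[of 0 q] x_mono[of "Suc q" m] assms by auto
    moreover have "gap m x p q = (if p = 0 then x (Suc q) - x p else min (x (Suc q) - x p) (x q - x (p - 1)))"
      using \<open>q < m\<close> calculation by (auto simp: gap_def)
    ultimately show ?thesis using that \<open>q < m\<close>
      by (cases "p = 0"; cases "x (Suc q) - x p \<le> x q - x (p - 1)") (simp_all add: min_def)
  qed
  then show ?thesis
  proof cases
    case 1
    show ?thesis
      by (rule exI[of _ p], rule exI[of _ "Suc q"])
         (use 1 assms wt_extend_right[of p q] in \<open>auto simp: Suc_diff_le\<close>)
  next
    case 2
    then obtain p' where "p = Suc p'" by (cases p) auto
    then show ?thesis
      by (intro exI[of _ p'] exI[of _ q])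
         (use 2 assms wt_extend_left[of p' q] in \<open>auto simp: Suc_diff_Suc\<close>)
  qed
qed

lemma gap_le_H:
  assumes "p \<le> q" "q \<le> m" "\<not> (p = 0 \<and> q = m)"
  shows "gap m x p q \<le> H"
  using gap_extend[OF assms] width_le by metis

text \<open>The range of integration is cut at \<open>gap m x p q\<close>; beyond it the cluster is enlarged by one node, which
  raises the exponent and trades a factor \<open>u\<close> of the weight.\<close>

lemma I_le:
  assumes "p + r + 1 \<le> q" "q \<le> m" "x q - x p \<le> A" "A \<le> B" "B \<le> H"
  shows "I (q - p - r) A B \<le> (1 + 2 ^ m) ^ (m - (q - p)) * (L * W p q B)"
  using assms
proof (induction "m - (q - p)" arbitrary: p q A B)
  case 0
  then have "p = 0" "q = m" by auto
  \<comment> \<open>No node is left outside, so \<open>H \<le> A \<le> B \<le> H\<close>.\<close>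
  then have "A = B" using 0 by simp
  then have "I (q - p - r) A B = 0" by (simp add: I_def)
  then show ?case
    using L_nonneg wt_nonneg[of B] H_pos \<open>A = B\<close> \<open>p = 0\<close> \<open>q = m\<close> 0 by simp
next
  case (Suc n)
  define d where "d = gap m x p q"
  define s where "s = q - p - r"
  have pos: "0 < x q - x p" using x_less Suc.prems by simp
  have A: "0 < A" using pos Suc.prems by simp
  have ne: "p \<le> q" "q \<le> m" "\<not> (p = 0 \<and> q = m)" using Suc by auto
  have LW: "0 \<le> L * W p q B" using L_nonneg wt_nonneg[of B] A Suc.prems by simp
  have low: "I s A' B' \<le> L * W p q B" if "A \<le> A'" "B' \<le> d" for A' B'
  proof -
    have "I s A' B' \<le> I s (x q - x p) d"
      using that pos Suc.prems by (intro I_subset) auto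
    also have "\<dots> \<le> L * W p q (x q - x p)"
      unfolding s_def d_def using Suc.prems by (intro I_gap_le) auto
    also have "\<dots> \<le> L * W p q B"
      using pos Suc.prems by (intro mult_left_mono wt_mono L_nonneg) auto
    finally show ?thesis .
  qed
  have high: "I s A' B \<le> 2 ^ m * ((1 + 2 ^ m) ^ n * (L * W p q B))" if "A \<le> A'" "d \<le> A'" "A' \<le> B" for A'
  proof -
    have B: "d \<le> B" "0 < B" using A that by auto
    obtain p' q' where p'q': "p' \<le> q'" "q' \<le> m" "q' - p' = Suc (q - p)" "x q' - x p' = d"
      "W p' q' B * B \<le> 2 ^ m * W p q B"
      using gap_extend[OF ne] B unfolding d_def[symmetric] by blast
    have "m - (q' - p') = n" "q' - p' - r = Suc s" "p' + r + 1 \<le> q'"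
      using p'q'(1-3) Suc.hyps(2) Suc.prems(1,2) by (auto simp: s_def)
    moreover have "x q' - x p' \<le> A'" using p'q' that by simp
    ultimately have "I (Suc s) A' B \<le> (1 + 2 ^ m) ^ n * (L * W p' q' B)"
      using Suc.hyps(1)[of q' p' A' B] p'q'(2) that(3) Suc.prems(5) by metis
    then have "B * I (Suc s) A' B \<le> B * ((1 + 2 ^ m) ^ n * (L * W p' q' B))"
      using A that by (intro mult_left_mono) auto
    also have "\<dots> = (1 + 2 ^ m) ^ n * (L * (W p' q' B * B))" by (simp only: mult_ac)
    also have "\<dots> \<le> (1 + 2 ^ m) ^ n * (L * (2 ^ m * W p q B))"
      by (intro mult_left_mono p'q' L_nonneg) simp
    finally have "B * I (Suc s) A' B \<le> 2 ^ m * ((1 + 2 ^ m) ^ n * (L * W p q B))" by (simp only: mult_ac)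
    moreover have "I s A' B \<le> B * I (Suc s) A' B" using A that by (intro I_raise) auto
    ultimately show ?thesis by linarith
  qed
  have high0: "0 \<le> 2 ^ m * ((1 + 2 ^ m) ^ n * (L * W p q B))" using LW by simp
  \<comment> \<open>Below the gap \<open>Lambda\<close> gives coefficient 1, above it the
    enlargement costs \<open>2 ^ m\<close>: a factor \<open>1 + 2 ^ m\<close> for each outside
    node.\<close>
  have "I s A B \<le> L * W p q B + 2 ^ m * ((1 + 2 ^ m) ^ n * (L * W p q B))"
  proof -
    consider "B \<le> d" | "d \<le> A" | "A \<le> d" "d \<le> B" by linarith
    then show ?thesis
    proof cases
      case 1
      then show ?thesis using low[of A B] high0 by simp
    next
      case 2
      then show ?thesis using high[of A] LW Suc.prems by simp
    next
      case 3
      then show ?thesis using low[of A d] high[of d] I_split[OF A 3, of s] by simp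
    qed
  qed
  also have "\<dots> \<le> (1 + 2 ^ m) ^ n * (L * W p q B) + 2 ^ m * ((1 + 2 ^ m) ^ n * (L * W p q B))"
    using mult_right_mono[of 1 "(1 + 2 ^ m) ^ n" "L * W p q B"] LW by simp
  also have "\<dots> = (1 + 2 ^ m) ^ Suc n * (L * W p q B)" by (simp add: algebra_simps)
  finally show ?case unfolding s_def Suc.hyps(2) .
qed

text \<open>Collects \<open>2 ^ Suc s\<close> from \<open>phi_le_I\<close>, \<open>2 ^ m\<close>
  from \<open>wt_double\<close> and \<open>(1 + 2 ^ m) ^ m\<close> from \<open>I_le\<close>, with
  \<open>s \<le> m\<close>.\<close>

definition K :: real where "K = 2 ^ (2 * m + 1) * (1 + 2 ^ m) ^ m"

lemma phi_le_aux:
  assumes "p + r + 1 \<le> q" "q \<le> m" "x q - x p \<le> u" "u \<le> H" "0 < u"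
  shows "\<phi> u / u ^ (q - p - r) \<le> K * (L * W p q u)"
proof -
  define s where "s = q - p - r"
  have s: "s + (m - (q - p)) = m - r" "s \<le> m" using assms by (auto simp: s_def)
  have LW: "0 \<le> L * W p q u" using L_nonneg wt_nonneg[of u] assms by simp
  show ?thesis
  proof (cases "2 * u \<le> H")
    case True
    have "L * W p q (2 * u) \<le> L * (2 ^ m * W p q u)"
      using assms by (intro mult_left_mono wt_double L_nonneg) auto
    then have LW2: "L * W p q (2 * u) \<le> 2 ^ m * (L * W p q u)" by (simp only: mult_ac)
    have "I s u (2 * u) \<le> (1 + 2 ^ m) ^ (m - (q - p)) * (L * W p q (2 * u))"
      unfolding s_def using assms True by (intro I_le) auto
    also have "\<dots> \<le> (1 + 2 ^ m) ^ m * (2 ^ m * (L * W p q u))"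
      by (rule mult_mono[OF _ LW2]) (use L_nonneg wt_nonneg[of "2 * u"] assms(5) in \<open>auto intro!: power_increasing\<close>)
    finally have I: "I s u (2 * u) \<le> (1 + 2 ^ m) ^ m * (2 ^ m * (L * W p q u))" .
    have "\<phi> u / u ^ s \<le> 2 ^ Suc s * I s u (2 * u)"
      using assms by (intro phi_le_I)
    also have "\<dots> \<le> 2 ^ Suc s * ((1 + 2 ^ m) ^ m * (2 ^ m * (L * W p q u)))"
      by (intro mult_left_mono I) simp
    also have "\<dots> = 2 ^ (Suc s + m) * (1 + 2 ^ m) ^ m * (L * W p q u)"
      unfolding power_add by (simp only: mult_ac)
    also have "\<dots> \<le> K * (L * W p q u)"
    proof -
      have "(2 :: real) ^ (Suc s + m) \<le> 2 ^ (2 * m + 1)"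
        using s(2) by (intro power_increasing) auto
      then show ?thesis
        unfolding K_def using LW by (intro mult_right_mono) auto
    qed
    finally show ?thesis unfolding s_def .
  next
    case False
    \<comment> \<open>\<open>[u, 2 * u]\<close> leaves the range of \<open>I_le\<close>, but
      \<open>u\<close> is comparable to \<open>H\<close>, so the value at \<open>H\<close> and the
      full cluster suffice.\<close>
    define n where "n = m - r"
    have "\<phi> H / H ^ n \<le> 2 ^ Suc n * L"
      using phi_le_I[OF H_pos, of n] I_full_le unfolding n_def
      by (meson mult_left_mono order_trans zero_le_numeral zero_le_power)
    then have phiH: "\<phi> H \<le> 2 ^ Suc n * L * H ^ n"
      using H_pos by (simp only: pos_divide_le_eq zero_less_power)
    have two: "(2 :: real) ^ Suc n * 2 ^ n = 2 ^ (2 * n + 1)"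
    proof -
      have "Suc n + n = 2 * n + 1" by simp
      then show ?thesis using power_add[of "2 :: real" "Suc n" n] by metis
    qed
    have un: "u ^ n = u ^ (m - (q - p)) * u ^ s"
      using power_add[of u s "m - (q - p)"] s(1) n_def by (simp only: mult.commute)
    have eq: "2 ^ Suc n * L * (2 * u) ^ n = 2 ^ (2 * n + 1) * (L * u ^ (m - (q - p))) * u ^ s"
      unfolding two[symmetric] power_mult_distrib un by (simp only: mult_ac)
    have "\<phi> u \<le> \<phi> H" using assms by (intro phi_mono)
    also have "\<dots> \<le> 2 ^ Suc n * L * H ^ n" by (rule phiH)
    also have "\<dots> \<le> 2 ^ Suc n * L * (2 * u) ^ n"
      using False H_pos L_nonneg by (intro mult_left_mono power_mono) auto
    also have "\<dots> \<le> 2 ^ (2 * n + 1) * (L * W p q u) * u ^ s"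
      unfolding eq using assms L_nonneg by (intro mult_right_mono mult_left_mono wt_ge_power) auto
    finally have "\<phi> u / u ^ s \<le> 2 ^ (2 * n + 1) * (L * W p q u)"
      using assms by (simp only: pos_divide_le_eq zero_less_power)
    also have "\<dots> \<le> (2 ^ (2 * m + 1) * 1) * (L * W p q u)"
    proof -
      have "(2 :: real) ^ (2 * n + 1) \<le> 2 ^ (2 * m + 1)"
        unfolding n_def by (intro power_increasing) auto
      then show ?thesis using LW by (intro mult_right_mono) auto
    qed
    also have "\<dots> \<le> K * (L * W p q u)"
      unfolding K_def using LW by (intro mult_right_mono mult_left_mono one_le_power) auto
    finally show ?thesis unfolding s_def .
  qed
qed

text \<open>A cluster of \<open>r + 1\<close> nodes has no term in \<open>Lambda\<close> and may be
  a single point. It is enlarged once, at a scale \<open>v\<close> that reaches its gap;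
  \<open>wt_gap_le\<close> brings the weight back to \<open>u\<close>.\<close>

lemma phi_le:
  assumes "p + r \<le> q" "q \<le> m" "x q - x p \<le> u" "u \<le> H" "0 < u"
  shows "\<phi> u / u ^ (q - p - r) \<le> 2 ^ m * K * (L * W p q u)"
proof (cases "q = p + r")
  case False
  have "0 \<le> K * (L * W p q u)"
    using L_nonneg wt_nonneg[of u] assms by (simp add: K_def)
  then have "K * (L * W p q u) \<le> 2 ^ m * (K * (L * W p q u))"
    using mult_right_mono[of 1 "2 ^ m" "K * (L * W p q u)"] by simp
  then show ?thesis using phi_le_aux[of p q u] assms False by simp
next
  case True
  have ne: "p \<le> q" "q \<le> m" "\<not> (p = 0 \<and> q = m)" using assms True r_less by auto
  define v where "v = max u (gap m x p q)"
  have v: "u \<le> v" "gap m x p q \<le> v" "v \<le> H" "0 < v"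
    using gap_le_H[OF ne] assms by (auto simp: v_def)
  obtain p' q' where p'q': "p' \<le> q'" "q' \<le> m" "q' - p' = Suc (q - p)" "x q' - x p' = gap m x p q"
    "W p' q' v * v \<le> 2 ^ m * W p q v"
    using gap_extend[OF ne] v by blast
  have "q' - p' - r = 1" "p' + r + 1 \<le> q'" using p'q' True by auto
  then have "\<phi> v / v \<le> K * (L * W p' q' v)"
    using phi_le_aux[of p' q' v] p'q' v by simp
  then have "\<phi> v \<le> K * L * (W p' q' v * v)"
    using v by (simp add: field_simps)
  also have "\<dots> \<le> K * L * (2 ^ m * W p q v)"
    using p'q' L_nonneg by (intro mult_left_mono) (auto simp: K_def)
  also have "\<dots> \<le> K * L * (2 ^ m * W p q u)"
    using wt_gap_le[OF ne(1,2), of u] L_nonneg assms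
    by (intro mult_left_mono) (auto simp: K_def v_def max_def)
  finally have "\<phi> v \<le> 2 ^ m * K * (L * W p q u)" by (simp add: mult_ac)
  moreover have "\<phi> u \<le> \<phi> v" using v assms by (intro phi_mono)
  ultimately show ?thesis using True by simp
qed

end

subsection \<open>Local polynomial approximation\<close>

lemma abs_divide_fact_le: "\<bar>z / fact n\<bar> \<le> \<bar>z :: real\<bar>"
  using mult_left_mono[of 1 "fact n :: real" "\<bar>z\<bar>"] by (simp add: abs_divide divide_le_eq)

text \<open>\<open>Cw\<close> and \<open>Cm\<close> are fixed before nodes and function, so the
  constants built from them and \<open>m\<close> are uniform.\<close>

locale smooth_nodes = nodes +
  fixes D :: "nat \<Rightarrow> real \<Rightarrow> real" and Cw Cm :: real
  assumes smooth: "Cr_on r D (x 0) (x m)"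
    and fdiff_le: "\<And>y u v. 0 < u \<Longrightarrow> u \<le> v \<Longrightarrow> x 0 \<le> y \<Longrightarrow> y + real (m - r) * u \<le> x m \<Longrightarrow>
      \<bar>fdiff (m - r) u (D r) y\<bar> \<le> \<phi> v"
    and whit: "\<And>a b g M. a < b \<Longrightarrow> continuous_on {a..b} g \<Longrightarrow>
      (\<And>y u. 0 < u \<Longrightarrow> a \<le> y \<Longrightarrow> y + real (m - r) * u \<le> b \<Longrightarrow> \<bar>fdiff (m - r) u g y\<bar> \<le> M) \<Longrightarrow>
      \<exists>P. degree P < m - r \<and> (\<forall>y\<in>{a..b}. \<bar>g y - poly P y\<bar> \<le> Cw * M)"
    and mark: "\<And>s p a b M y. s \<le> m \<Longrightarrow> degree p \<le> m \<Longrightarrow> a < b \<Longrightarrow> (\<forall>y\<in>{a..b}. \<bar>poly p y\<bar> \<le> M) \<Longrightarrow>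
      y \<in> {a..b} \<Longrightarrow> \<bar>poly ((pderiv ^^ s) p) y\<bar> \<le> Cm * M / (b - a) ^ s"
    and Cw_nonneg: "0 \<le> Cw" and Cm_nonneg: "0 \<le> Cm"
begin

lemma local_approx:
  assumes "x 0 \<le> a" "a < b" "b \<le> x m"
  shows "\<exists>Q. degree Q < m \<and> (\<forall>y\<in>{a..b}. \<bar>D r y - poly ((pderiv ^^ r) Q) y\<bar> \<le> Cw * \<phi> (b - a))"
proof -
  have "continuous_on {x 0..x m} (D r)" using smooth by (simp add: Cr_on_def)
  then have "continuous_on {a..b} (D r)" by (rule continuous_on_subset) (use assms in auto)
  moreover have "\<bar>fdiff (m - r) u (D r) y\<bar> \<le> \<phi> (b - a)"
    if "0 < u" "a \<le> y" "y + real (m - r) * u \<le> b" for y u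
  proof (rule fdiff_le)
    \<comment> \<open>As \<open>m - r \<ge> 1\<close>, a difference that fits in
      \<open>[a, b]\<close> has step at most \<open>b - a\<close>.\<close>
    have "1 * u \<le> real (m - r) * u" using r_less that by (intro mult_right_mono) auto
    then show "u \<le> b - a" using that by linarith
  qed (use that assms in auto)
  ultimately obtain P where P: "degree P < m - r" "\<forall>y\<in>{a..b}. \<bar>D r y - poly P y\<bar> \<le> Cw * \<phi> (b - a)"
    using whit[OF assms(2)] by blast
  obtain Q where "(pderiv ^^ r) Q = P" "degree Q \<le> degree P + r"
    using poly_antiderivative by blast
  then show ?thesis using P by (intro exI[of _ Q]) auto
qed

text \<open>One fixed choice per interval, so that differences along a chain of intervals
  telescope.\<close>

definition Q :: "real \<Rightarrow> real \<Rightarrow> real poly" where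
  "Q a b = (SOME Q. degree Q < m \<and> (\<forall>y\<in>{a..b}. \<bar>D r y - poly ((pderiv ^^ r) Q) y\<bar> \<le> Cw * \<phi> (b - a)))"

lemma Q:
  assumes "x 0 \<le> a" "a < b" "b \<le> x m"
  shows degree_Q: "degree (Q a b) < m"
    and Q_approx: "y \<in> {a..b} \<Longrightarrow> \<bar>D r y - poly ((pderiv ^^ r) (Q a b)) y\<bar> \<le> Cw * \<phi> (b - a)"
  using someI_ex[OF local_approx[OF assms]] unfolding Q_def[symmetric] by blast+

text \<open>On the smaller interval the \<open>r\<close>-th derivatives of both polynomials follow
  \<open>D r\<close>; Markov's inequality there costs \<open>(b - a) ^ s\<close>.\<close>

lemma Q_diff_deriv:
  assumes "x 0 \<le> a'" "a' \<le> a" "a < b" "b \<le> b'" "b' \<le> x m" "y \<in> {a..b}" "s \<le> m"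
  shows "\<bar>poly ((pderiv ^^ (s + r)) (Q a b - Q a' b')) y\<bar> \<le> 2 * Cm * Cw * (\<phi> (b' - a') / (b - a) ^ s)"
proof -
  define R where "R = (pderiv ^^ r) (Q a b - Q a' b')"
  have "degree (Q a b) < m" "degree (Q a' b') < m" using assms by (auto intro!: degree_Q)
  then have "degree R \<le> m"
    using degree_diff_less[of "Q a b" m "Q a' b'"] by (simp add: R_def degree_higher_pderiv)
  moreover have "\<bar>poly R z\<bar> \<le> 2 * Cw * \<phi> (b' - a')" if z: "z \<in> {a..b}" for z
  proof -
    have "\<bar>D r z - poly ((pderiv ^^ r) (Q a b)) z\<bar> \<le> Cw * \<phi> (b - a)"
      using assms z by (intro Q_approx) auto
    also have "\<dots> \<le> Cw * \<phi> (b' - a')"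
      using assms Cw_nonneg by (intro mult_left_mono phi_mono) auto
    finally have "\<bar>D r z - poly ((pderiv ^^ r) (Q a b)) z\<bar> \<le> Cw * \<phi> (b' - a')" .
    moreover have "\<bar>D r z - poly ((pderiv ^^ r) (Q a' b')) z\<bar> \<le> Cw * \<phi> (b' - a')"
      using assms z by (intro Q_approx) auto
    ultimately show ?thesis by (simp add: R_def higher_pderiv_diff)
  qed
  ultimately have "\<bar>poly ((pderiv ^^ s) R) y\<bar> \<le> Cm * (2 * Cw * \<phi> (b' - a')) / (b - a) ^ s"
    using assms by (intro mark) auto
  then show ?thesis by (simp add: R_def funpow_add mult_ac)
qed

text \<open>\<open>4 ^ Suc m\<close> covers both \<open>2 ^ (s + Suc s)\<close> for a doubling and
  \<open>4 ^ s\<close> for the last jump with \<open>h \<le> 4 * t\<close>.\<close>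

definition Cc :: real where "Cc = 2 * Cm * Cw * 4 ^ Suc m"

lemma Cc_nonneg: "0 \<le> Cc"
  using Cm_nonneg Cw_nonneg by (simp add: Cc_def)

text \<open>Passing from the polynomial at scale \<open>t\<close> to the one at scale \<open>h\<close> by repeatedly doubling
  the interval; the integral absorbs all doublings except the last one.\<close>

lemma Q_chain:
  assumes width: "\<And>t. hi t - lo t = t"
    and nested: "\<And>t t'. 0 < t \<Longrightarrow> t \<le> t' \<Longrightarrow> t' \<le> h \<Longrightarrow> lo t' \<le> lo t \<and> hi t \<le> hi t'"
    and inside: "x 0 \<le> lo h" "hi h \<le> x m"
    and "0 < t" "t \<le> h" "y \<in> {lo t..hi t}" "s \<le> m"
  shows "\<bar>poly ((pderiv ^^ (s + r)) (Q (lo t) (hi t) - Q (lo h) (hi h))) y\<bar>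
    \<le> Cc * (I s (min (2 * t) h) h + \<phi> h / h ^ s)"
proof -
  define P where "P t = Q (lo t) (hi t)" for t
  define E where "E t = I s (min (2 * t) h) h" for t
  have h: "0 < h" using assms by simp
  have E_nonneg: "0 \<le> E t" if "0 < t" for t
    using that h by (auto simp: E_def intro!: I_nonneg)
  have phi_h: "0 \<le> \<phi> h / h ^ s" using h by (simp add: phi_nonneg)
  have step: "\<bar>poly ((pderiv ^^ (s + r)) (P t - P t')) y\<bar> \<le> 2 * Cm * Cw * (\<phi> t' / t ^ s)"
    if "0 < t" "t \<le> t'" "t' \<le> h" "y \<in> {lo t..hi t}" for t t'
    using Q_diff_deriv[of "lo t'" "lo t" "hi t" "hi t'" y s] nested[of t t'] nested[of t' h]
      inside width[of t] width[of t'] that \<open>s \<le> m\<close> unfolding P_def by auto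
  have direct: "\<bar>poly ((pderiv ^^ (s + r)) (P t - P h)) y\<bar> \<le> Cc * (E t + \<phi> h / h ^ s)"
    if t: "0 < t" "t \<le> h" "y \<in> {lo t..hi t}" and ht: "h \<le> 4 * t" for t
  proof -
    have "h ^ s \<le> (4 * t) ^ s" using h ht by (intro power_mono) auto
    also have "\<dots> = 4 ^ s * t ^ s" by (rule power_mult_distrib)
    also have "\<dots> \<le> 4 ^ Suc m * t ^ s"
      using t \<open>s \<le> m\<close> by (intro mult_right_mono power_increasing) auto
    finally have "1 / t ^ s \<le> 4 ^ Suc m * (1 / h ^ s)" using t h by (simp add: field_simps)
    then have "\<phi> h * (1 / t ^ s) \<le> \<phi> h * (4 ^ Suc m * (1 / h ^ s))"
      using h by (intro mult_left_mono phi_nonneg)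
    then have "2 * Cm * Cw * (\<phi> h / t ^ s) \<le> 2 * Cm * Cw * (4 ^ Suc m * (\<phi> h / h ^ s))"
      using Cm_nonneg Cw_nonneg by (intro mult_left_mono) (auto simp: mult_ac)
    also have "\<dots> = Cc * (\<phi> h / h ^ s)" unfolding Cc_def by (simp only: mult_ac)
    also have "\<dots> \<le> Cc * (E t + \<phi> h / h ^ s)"
      using E_nonneg[OF t(1)] Cc_nonneg by (intro mult_left_mono) auto
    finally show ?thesis using step[of t h] t by simp
  qed
  \<comment> \<open>\<open>n\<close> bounds the number of doublings before \<open>direct\<close>
    applies.\<close>
  obtain n :: nat where "h / t < 2 ^ n" using real_arch_pow[of 2 "h / t"] by auto
  then have "h < 2 ^ n * t" using \<open>0 < t\<close> by (simp only: pos_divide_less_eq)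
  moreover have "0 \<le> 2 ^ n * t" using \<open>0 < t\<close> by simp
  ultimately have "h \<le> 4 * (2 ^ n * t)" by linarith
  with \<open>0 < t\<close> \<open>t \<le> h\<close> \<open>y \<in> {lo t..hi t}\<close>
  have "\<bar>poly ((pderiv ^^ (s + r)) (P t - P h)) y\<bar> \<le> Cc * (E t + \<phi> h / h ^ s)"
  proof (induction n arbitrary: t)
    case (0 t)
    then show ?case by (intro direct) auto
  next
    case (Suc n t)
    show ?case
    proof (cases "h \<le> 4 * t")
      case True
      then show ?thesis using Suc.prems by (intro direct) auto
    next
      case False
      have t: "0 < t" "0 < 2 * t" "2 * t \<le> h" using Suc.prems False by auto
      have "y \<in> {lo (2 * t)..hi (2 * t)}" using Suc.prems nested[of t "2 * t"] t by auto
      then have IH: "\<bar>poly ((pderiv ^^ (s + r)) (P (2 * t) - P h)) y\<bar> \<le> Cc * (E (2 * t) + \<phi> h / h ^ s)"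
        using t Suc.prems by (intro Suc.IH) (auto simp: mult_ac)
      \<comment> \<open>The jump from \<open>t\<close> to \<open>2 * t\<close> is charged to
        \<open>[2 * t, 4 * t]\<close>, which ends before \<open>h\<close> because
        \<open>4 * t < h\<close>; hence the integral in \<open>E\<close> starts at
        \<open>2 * t\<close>.\<close>
      have "\<phi> (2 * t) / t ^ s = 2 ^ s * (\<phi> (2 * t) / (2 * t) ^ s)"
        by (simp add: power_mult_distrib)
      also have "\<dots> \<le> 2 ^ s * (2 ^ Suc s * I s (2 * t) (2 * (2 * t)))"
        using t by (intro mult_left_mono phi_le_I) auto
      also have "\<dots> = 2 ^ (s + Suc s) * I s (2 * t) (4 * t)" by (simp add: power_add)
      also have "\<dots> \<le> 2 ^ (2 * Suc m) * I s (2 * t) (4 * t)"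
        using t \<open>s \<le> m\<close> by (intro mult_right_mono power_increasing I_nonneg) auto
      also have "\<dots> = 4 ^ Suc m * I s (2 * t) (4 * t)" by (simp only: power_mult) simp
      finally have "2 * Cm * Cw * (\<phi> (2 * t) / t ^ s) \<le> 2 * Cm * Cw * (4 ^ Suc m * I s (2 * t) (4 * t))"
        using Cm_nonneg Cw_nonneg by (intro mult_left_mono) auto
      also have "\<dots> = Cc * I s (2 * t) (4 * t)" unfolding Cc_def by (simp only: mult_ac)
      finally have "\<bar>poly ((pderiv ^^ (s + r)) (P t - P (2 * t))) y\<bar> \<le> Cc * I s (2 * t) (4 * t)"
        using step[of t "2 * t"] Suc.prems t by simp
      moreover have "E t = I s (2 * t) (4 * t) + E (2 * t)"
        using I_split[of "2 * t" "4 * t" h s] t False by (simp add: E_def min_def)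
      moreover have "(pderiv ^^ (s + r)) (P t - P h)
          = (pderiv ^^ (s + r)) (P t - P (2 * t)) + (pderiv ^^ (s + r)) (P (2 * t) - P h)"
        unfolding higher_pderiv_add[symmetric] by simp
      ultimately show ?thesis using IH by (simp add: algebra_simps)
    qed
  qed
  then show ?thesis unfolding P_def E_def .
qed

text \<open>The common end point anchors the chain of intervals, and the mean value theorem turns
  the divided difference into a derivative of order \<open>s + r\<close>. The integral in
  \<open>Q_chain\<close> starts no lower than \<open>x q - x p\<close>, as \<open>I_le\<close>
  requires.\<close>

lemma dd_Q_diff:
  assumes pq: "p + r + 1 \<le> q" "q \<le> m"
    and sub: "x 0 \<le> a" "a \<le> x p" "x q \<le> b" "b \<le> x m" and side: "a = x p \<or> b = x q"
  shows "\<bar>dd (\<lambda>i. poly ((pderiv ^^ i) (Q (x p) (x q) - Q a b))) x p q\<bar>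
    \<le> Cc * ((1 + 2 ^ m) ^ m + 2 ^ m * K) * (L * W p q (b - a))"
proof -
  define s t h where "s = q - p - r" and "t = x q - x p" and "h = b - a"
  have t: "0 < t" "t \<le> h" "h \<le> H" using x_less[OF pq] sub by (auto simp: t_def h_def)
  have s: "q - p = s + r" "s \<le> m" using pq by (auto simp: s_def)
  have "\<exists>\<xi>\<in>{x p..x q}. dd (\<lambda>i. poly ((pderiv ^^ i) (Q (x p) (x q) - Q a b))) x p q
      = poly ((pderiv ^^ (q - p)) (Q (x p) (x q) - Q a b)) \<xi> / fact (q - p)"
    using pq x_mono by (intro dd_mvt Cr_on_poly) auto
  then obtain \<xi> where xi: "\<xi> \<in> {x p..x q}"
    "dd (\<lambda>i. poly ((pderiv ^^ i) (Q (x p) (x q) - Q a b))) x p q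
      = poly ((pderiv ^^ (s + r)) (Q (x p) (x q) - Q a b)) \<xi> / fact (q - p)"
    unfolding s by blast
  have "\<bar>poly ((pderiv ^^ (s + r)) (Q (x p) (x q) - Q a b)) \<xi>\<bar> \<le> Cc * (I s (min (2 * t) h) h + \<phi> h / h ^ s)"
  proof (cases "a = x p")
    case True
    show ?thesis
      using Q_chain[of "\<lambda>t. a + t" "\<lambda>t. a" h t \<xi> s] True xi sub t s by (simp add: t_def h_def)
  next
    case False
    then have "b = x q" using side by simp
    then show ?thesis
      using Q_chain[of "\<lambda>t. b" "\<lambda>t. b - t" h t \<xi> s] xi sub t s by (simp add: t_def h_def)
  qed
  also have "\<dots> \<le> Cc * ((1 + 2 ^ m) ^ m * (L * W p q h) + 2 ^ m * K * (L * W p q h))"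
  proof (intro mult_left_mono add_mono Cc_nonneg)
    have "I s (min (2 * t) h) h \<le> (1 + 2 ^ m) ^ (m - (q - p)) * (L * W p q h)"
      unfolding s_def using t by (intro I_le pq) (auto simp: t_def)
    also have "\<dots> \<le> (1 + 2 ^ m) ^ m * (L * W p q h)"
      using L_nonneg wt_nonneg[of h] t by (intro mult_right_mono power_increasing) auto
    finally show "I s (min (2 * t) h) h \<le> (1 + 2 ^ m) ^ m * (L * W p q h)" .
    show "\<phi> h / h ^ s \<le> 2 ^ m * K * (L * W p q h)"
      unfolding s_def using pq t by (intro phi_le) (auto simp: t_def)
  qed
  also have "\<dots> = Cc * ((1 + 2 ^ m) ^ m + 2 ^ m * K) * (L * W p q h)"
    by (simp only: ring_distribs mult.assoc)
  finally have le: "\<bar>poly ((pderiv ^^ (s + r)) (Q (x p) (x q) - Q a b)) \<xi>\<bar>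
      \<le> Cc * ((1 + 2 ^ m) ^ m + 2 ^ m * K) * (L * W p q h)" .
  show ?thesis
    unfolding xi(2) using order.trans[OF abs_divide_fact_le le] unfolding h_def .
qed

text \<open>The first pair selects the polynomial, the second the nodes, so that a child can keep
  the polynomial of its parent until it is exchanged.\<close>

definition rem :: "nat \<Rightarrow> nat \<Rightarrow> nat \<Rightarrow> nat \<Rightarrow> real" where
  "rem p q p' q' = dd (\<lambda>i y. D i y - poly ((pderiv ^^ i) (Q (x p) (x q))) y) x p' q'"

text \<open>The first summand pays for the stopping case, the second for one exchange of
  polynomials.\<close>

definition K4 :: real where "K4 = Cw * (2 ^ m * K) + Cc * ((1 + 2 ^ m) ^ m + 2 ^ m * K)"

lemma K_nonneg: "0 \<le> K" by (simp add: K_def)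

lemma K4_nonneg: "0 \<le> K4"
  unfolding K4_def using K_nonneg Cw_nonneg Cc_nonneg by simp

text \<open>The scale is that of the parent, which is positive even if the nodes of the child
  coincide.\<close>

lemma rem_child_base:
  assumes "p \<le> p'" "q' \<le> q" "q \<le> m" "q' = p' + r" "x p < x q"
  shows "\<bar>rem p q p' q'\<bar> \<le> K4 * (L * W p' q' (x q - x p))"
proof -
  define h where "h = x q - x p"
  have sub: "x 0 \<le> x p" "x p \<le> x p'" "x p' \<le> x q'" "x q' \<le> x q" "x q \<le> x m"
    using assms by (auto intro!: x_mono)
  have h: "0 < h" "h \<le> H" using sub assms by (auto simp: h_def)
  have "\<exists>\<xi>\<in>{x p'..x q'}. rem p q p' q' = (D (q' - p') \<xi> - poly ((pderiv ^^ (q' - p')) (Q (x p) (x q))) \<xi>) / fact (q' - p')"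
    unfolding rem_def
  proof (rule dd_mvt)
    have "Cr_on r D (x p') (x q')"
      by (rule Cr_on_subset[OF smooth]) (use sub in auto)
    then show "Cr_on (q' - p') (\<lambda>i y. D i y - poly ((pderiv ^^ i) (Q (x p) (x q))) y) (x p') (x q')"
      using assms(4) by (intro Cr_on_diff Cr_on_poly) simp
  qed (use assms in \<open>auto intro!: x_mono\<close>)
  then obtain \<xi> where xi: "\<xi> \<in> {x p'..x q'}"
    "rem p q p' q' = (D r \<xi> - poly ((pderiv ^^ r) (Q (x p) (x q))) \<xi>) / fact r"
    using assms(4) by auto
  have "\<bar>rem p q p' q'\<bar> \<le> \<bar>D r \<xi> - poly ((pderiv ^^ r) (Q (x p) (x q))) \<xi>\<bar>"
    unfolding xi(2) by (rule abs_divide_fact_le)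
  also have "\<dots> \<le> Cw * \<phi> h"
    unfolding h_def using xi sub assms by (intro Q_approx) auto
  also have "\<dots> \<le> Cw * (2 ^ m * K * (L * W p' q' h))"
    using phi_le[of p' q' h] assms sub h Cw_nonneg by (intro mult_left_mono) (auto simp: h_def)
  also have "\<dots> \<le> K4 * (L * W p' q' h)"
  proof -
    have "0 \<le> L * W p' q' h" using L_nonneg wt_nonneg h by simp
    moreover have "Cw * (2 ^ m * K) \<le> K4"
      unfolding K4_def using K_nonneg Cc_nonneg by simp
    ultimately have "Cw * (2 ^ m * K) * (L * W p' q' h) \<le> K4 * (L * W p' q' h)"
      by (rule mult_right_mono[rotated])
    then show ?thesis by (simp only: mult.assoc)
  qed
  finally show ?thesis unfolding h_def .
qed

lemma rem_child_step:
  assumes "p \<le> p'" "q' \<le> q" "q \<le> m" "p' + r + 1 \<le> q'" "p = p' \<or> q = q'"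
    and IH: "\<bar>rem p' q' p' q'\<bar> \<le> c * (L * W p' q' (x q' - x p'))" and "0 \<le> c"
  shows "\<bar>rem p q p' q'\<bar> \<le> (c + K4) * (L * W p' q' (x q - x p))"
proof -
  have sub: "x 0 \<le> x p" "x p \<le> x p'" "x p' \<le> x q'" "x q' \<le> x q" "x q \<le> x m"
    using assms by (auto intro!: x_mono)
  define E where "E = dd (\<lambda>i. poly ((pderiv ^^ i) (Q (x p') (x q') - Q (x p) (x q)))) x p' q'"
  have "(\<lambda>i. poly ((pderiv ^^ i) (Q (x p') (x q') - Q (x p) (x q))))
      = (\<lambda>i y. (D i y - poly ((pderiv ^^ i) (Q (x p) (x q))) y) - (D i y - poly ((pderiv ^^ i) (Q (x p') (x q'))) y))"
    by (simp add: higher_pderiv_diff fun_eq_iff)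
  then have "E = rem p q p' q' - rem p' q' p' q'"
    unfolding E_def rem_def by (simp only: dd_diff)
  moreover have "\<bar>E\<bar> \<le> K4 * (L * W p' q' (x q - x p))"
  proof -
    have "\<bar>E\<bar> \<le> Cc * ((1 + 2 ^ m) ^ m + 2 ^ m * K) * (L * W p' q' (x q - x p))"
      unfolding E_def by (rule dd_Q_diff) (use assms sub in auto)
    also have "\<dots> \<le> K4 * (L * W p' q' (x q - x p))"
      unfolding K4_def using K_nonneg Cw_nonneg L_nonneg wt_nonneg sub by (intro mult_right_mono) auto
    finally show ?thesis .
  qed
  moreover have "c * (L * W p' q' (x q' - x p')) \<le> c * (L * W p' q' (x q - x p))"
    using sub \<open>0 \<le> c\<close> by (intro mult_left_mono wt_mono L_nonneg) auto
  ultimately have "\<bar>rem p q p' q'\<bar> \<le> c * (L * W p' q' (x q - x p)) + K4 * (L * W p' q' (x q - x p))"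
    using IH by linarith
  then show ?thesis by (simp only: distrib_right)
qed

text \<open>The dropped node enters the weight with factor exactly \<open>x q - x p\<close> and no
  other factor grows; the recursion divides by just this length.\<close>

lemma wt_shrink_left:
  assumes "p < q" "q \<le> m"
  shows "W (Suc p) q (x q - x p) \<le> (x q - x p) * W p q (x q - x p)"
proof -
  define h where "h = x q - x p"
  have h: "0 \<le> h" using x_mono[of p q] assms by (simp add: h_def)
  have "(\<Prod>i\<in>{Suc q..m}. max (x i - x (Suc p)) h) \<le> (\<Prod>i\<in>{Suc q..m}. max (x i - x p) h)"
    using h x_mono[of p "Suc p"] assms by (intro prod_mono) (auto simp: max_def)
  then have "((\<Prod>i<p. max (x q - x i) h) * h) * (\<Prod>i\<in>{Suc q..m}. max (x i - x (Suc p)) h)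
      \<le> ((\<Prod>i<p. max (x q - x i) h) * h) * (\<Prod>i\<in>{Suc q..m}. max (x i - x p) h)"
    using h by (intro mult_left_mono mult_nonneg_nonneg prod_nonneg) auto
  then show ?thesis unfolding h_def[symmetric] wt_def by (simp add: h_def[symmetric] mult_ac)
qed

lemma wt_shrink_right:
  assumes "p < q" "q \<le> m"
  shows "W p (q - 1) (x q - x p) \<le> (x q - x p) * W p q (x q - x p)"
proof -
  define h where "h = x q - x p"
  have h: "0 \<le> h" using x_mono[of p q] assms by (simp add: h_def)
  have "(\<Prod>i<p. max (x (q - 1) - x i) h) \<le> (\<Prod>i<p. max (x q - x i) h)"
    using h x_mono[of "q - 1" q] assms by (intro prod_mono) (auto simp: max_def)
  then have "(\<Prod>i<p. max (x (q - 1) - x i) h) * (h * (\<Prod>i\<in>{Suc q..m}. max (x i - x p) h))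
      \<le> (\<Prod>i<p. max (x q - x i) h) * (h * (\<Prod>i\<in>{Suc q..m}. max (x i - x p) h))"
    using h by (intro mult_right_mono mult_nonneg_nonneg prod_nonneg) auto
  moreover have "(\<Prod>i\<in>{Suc (q - 1)..m}. max (x i - x p) h) = h * (\<Prod>i\<in>{Suc q..m}. max (x i - x p) h)"
    using assms by (subst prod.atLeast_Suc_atMost) (auto simp: h_def)
  ultimately show ?thesis unfolding h_def[symmetric] wt_def by (simp add: mult_ac)
qed

lemma rem_le:
  assumes "p + r + 1 \<le> q" "q \<le> m"
  shows "\<bar>rem p q p q\<bar> \<le> 4 ^ (q - p - r) * K4 * (L * W p q (x q - x p))"
  using assms
proof (induction "q - p" arbitrary: p q rule: less_induct)
  case less
  define h where "h = x q - x p"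
  have pq: "p < q" "x p < x q" using x_less less.prems by auto
  then have h: "0 < h" by (simp add: h_def)
  obtain n where n: "q - p - r = Suc n" using less.prems by (metis Suc_diff_Suc add.assoc diff_diff_left
        less_eq_Suc_le plus_1_eq_Suc add.commute)
  \<comment> \<open>Each of the two children brings its own \<open>4 ^ n * K4\<close> plus
    \<open>K4\<close> for the exchange, at most \<open>c\<close>; together this is a factor 4 per
    level.\<close>
  define c where "c = 2 * 4 ^ n * K4"
  have c: "K4 \<le> c" "4 ^ n * K4 + K4 \<le> c" "0 \<le> c"
    using K4_nonneg mult_right_mono[of 1 "4 ^ n" K4] by (auto simp: c_def mult.commute)
  have child: "\<bar>rem p q p' q'\<bar> \<le> c * (L * W p' q' h)"
    if p'q': "p \<le> p'" "q' \<le> q" "q' - p' = n + r" "p' \<le> q'" "p = p' \<or> q = q'" for p' q'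
  proof -
    have LW: "0 \<le> L * W p' q' h" using L_nonneg wt_nonneg h by simp
    show ?thesis
    proof (cases "n = 0")
      case True
      then have "\<bar>rem p q p' q'\<bar> \<le> K4 * (L * W p' q' h)"
        unfolding h_def using p'q' pq less.prems by (intro rem_child_base) auto
      also have "\<dots> \<le> c * (L * W p' q' h)" using c LW by (intro mult_right_mono)
      finally show ?thesis .
    next
      case False
      have "\<bar>rem p' q' p' q'\<bar> \<le> 4 ^ (q' - p' - r) * K4 * (L * W p' q' (x q' - x p'))"
        by (rule less.hyps) (use p'q' n False less.prems in auto)
      then have "\<bar>rem p q p' q'\<bar> \<le> (4 ^ n * K4 + K4) * (L * W p' q' h)"
        unfolding h_def using p'q' False less.prems K4_nonneg by (intro rem_child_step) auto
      also have "\<dots> \<le> c * (L * W p' q' h)" using c LW by (intro mult_right_mono)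
      finally show ?thesis .
    qed
  qed
  have "\<bar>rem p q (Suc p) q\<bar> \<le> c * (L * W (Suc p) q h)"
    by (rule child) (use n pq in auto)
  also have "\<dots> \<le> c * (L * (h * W p q h))"
    unfolding h_def using pq less.prems c L_nonneg by (intro mult_left_mono wt_shrink_left) auto
  finally have 1: "\<bar>rem p q (Suc p) q\<bar> \<le> c * (L * W p q h) * h" by (simp only: mult_ac)
  have "\<bar>rem p q p (q - 1)\<bar> \<le> c * (L * W p (q - 1) h)"
    by (rule child) (use n pq in auto)
  also have "\<dots> \<le> c * (L * (h * W p q h))"
    unfolding h_def using pq less.prems c L_nonneg by (intro mult_left_mono wt_shrink_right) auto
  finally have 2: "\<bar>rem p q p (q - 1)\<bar> \<le> c * (L * W p q h) * h" by (simp only: mult_ac)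
  have "rem p q p q = (rem p q (Suc p) q - rem p q p (q - 1)) / h"
    unfolding rem_def h_def using pq by (rule dd_rec)
  then have "\<bar>rem p q p q\<bar> * h = \<bar>rem p q (Suc p) q - rem p q p (q - 1)\<bar>"
    using h by (simp add: abs_divide)
  also have "\<dots> \<le> 2 * (c * (L * W p q h)) * h" using 1 2 by linarith
  finally have "\<bar>rem p q p q\<bar> \<le> 2 * (c * (L * W p q h))" using h by simp
  also have "\<dots> = 4 ^ Suc n * K4 * (L * W p q h)" by (simp add: c_def)
  finally show ?case unfolding n h_def .
qed

theorem dd_le: "\<bar>dd D x 0 m\<bar> \<le> 4 ^ m * K4 * L"
proof -
  have "\<exists>\<xi>\<in>{x 0..x m}. dd (\<lambda>i. poly ((pderiv ^^ i) (Q (x 0) (x m)))) x 0 m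
      = poly ((pderiv ^^ (m - 0)) (Q (x 0) (x m))) \<xi> / fact (m - 0)"
    using x_mono by (intro dd_mvt Cr_on_poly) auto
  moreover have "degree (Q (x 0) (x m)) < m" using H_pos by (intro degree_Q) auto
  then have "(pderiv ^^ m) (Q (x 0) (x m)) = 0"
    by (intro poly_eqI) (simp add: coeff_higher_pderiv coeff_eq_0)
  ultimately have "dd (\<lambda>i. poly ((pderiv ^^ i) (Q (x 0) (x m)))) x 0 m = 0"
    by (simp del: upt_Suc)
  then have "dd D x 0 m = rem 0 m 0 m"
    unfolding rem_def dd_diff[of D "\<lambda>i. poly ((pderiv ^^ i) (Q (x 0) (x m)))"] by linarith
  then have "\<bar>dd D x 0 m\<bar> \<le> 4 ^ (m - 0 - r) * K4 * (L * W 0 m (x m - x 0))"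
    using rem_le[of 0 m] r_less by simp
  also have "\<dots> = 4 ^ (m - r) * (K4 * L)" by (simp add: wt_full)
  also have "\<dots> \<le> 4 ^ m * (K4 * L)"
    using K4_nonneg L_nonneg by (intro mult_right_mono power_increasing) auto
  finally show ?thesis by (simp only: mult.assoc)
qed

end

text \<open>Nonnegativity of \<open>Lambda\<close> is exported too, because the constants for
  different \<open>r\<close> are later enlarged to a common one.\<close>

lemma divided_difference_bound:
  fixes m r :: nat
  assumes "r < m"
  shows "\<exists>c\<ge>0. \<forall>(x::nat \<Rightarrow> real) (D::nat \<Rightarrow> real \<Rightarrow> real).
     (\<forall>j<m. x j \<le> x (Suc j)) \<longrightarrow>
     (\<forall>j. j + r + 1 \<le> m \<longrightarrow> x j < x (j + r + 1)) \<longrightarrow>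
     Cr_on r D (x 0) (x m) \<longrightarrow>
     0 \<le> Lambda r m x (modsmooth (m - r) (D r) (x 0) (x m)) \<and>
     \<bar>divdiff D (map x [0..<Suc m])\<bar> \<le> c * Lambda r m x (modsmooth (m - r) (D r) (x 0) (x m))"
proof -
  obtain Cw where Cw: "Cw > 0"
    "\<And>a b g M. a < b \<Longrightarrow> continuous_on {a..b} g \<Longrightarrow>
      (\<And>y u. 0 < u \<Longrightarrow> a \<le> y \<Longrightarrow> y + real (m - r) * u \<le> b \<Longrightarrow> \<bar>fdiff (m - r) u g y\<bar> \<le> M) \<Longrightarrow>
      \<exists>P. degree P < m - r \<and> (\<forall>y\<in>{a..b}. \<bar>g y - poly P y\<bar> \<le> Cw * M)"
    using whitney[of "m - r"] assms by (metis zero_less_diff)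
  obtain Cm where Cm: "Cm \<ge> 0"
    "\<And>s p (a::real) b M y. s \<le> m \<Longrightarrow> degree p \<le> m \<Longrightarrow> a < b \<Longrightarrow> (\<forall>y\<in>{a..b}. \<bar>poly p y\<bar> \<le> M) \<Longrightarrow>
      y \<in> {a..b} \<Longrightarrow> \<bar>poly ((pderiv ^^ s) p) y\<bar> \<le> Cm * M / (b - a) ^ s"
    using markov_uniform[of m m] by blast
  show ?thesis
  \<comment> \<open>The absolute value makes the constant nonnegative before there are nodes with
    which to interpret the locale.\<close>
  proof (intro exI[of _ "\<bar>4 ^ m * smooth_nodes.K4 m Cw Cm\<bar>"] conjI allI impI)
    fix x :: "nat \<Rightarrow> real" and D
    assume "\<forall>j<m. x j \<le> x (Suc j)" and sep: "\<forall>j. j + r + 1 \<le> m \<longrightarrow> x j < x (j + r + 1)"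
      and C: "Cr_on r D (x 0) (x m)"
    define \<phi> where "\<phi> = modsmooth (m - r) (D r) (x 0) (x m)"
    have mono: "x i \<le> x j" if "i \<le> j" "j \<le> m" for i j
      using that
    proof (induction j rule: dec_induct)
      case (step n)
      then have "x n \<le> x (Suc n)" using \<open>\<forall>j<m. x j \<le> x (Suc j)\<close> by simp
      then show ?case using step by simp
    qed simp
    have le: "x 0 \<le> x m" using mono by simp
    have cont: "continuous_on {x 0..x m} (D r)" using C by (simp add: Cr_on_def)
    interpret smooth_nodes m r x \<phi> D Cw Cm
    proof
      show "\<bar>fdiff (m - r) u (D r) y\<bar> \<le> \<phi> v"
        if "0 < u" "u \<le> v" "x 0 \<le> y" "y + real (m - r) * u \<le> x m" for y u v
      proof -
        define w where "w = real (m - r) * u"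
        have "0 \<le> w" "y + w \<le> x m" "real (m - r) / 2 * u = w / 2" using that by (auto simp: w_def)
        then have "y + real (m - r) / 2 * u \<in> {x 0..x m}" using that(3) by auto
        then show ?thesis
          unfolding \<phi>_def sym_diff_eq_fdiff[OF that(3,4), symmetric]
          by (intro sym_diff_le_modsmooth le cont that)
      qed
    qed (use assms mono sep C Cw Cm le cont in
         \<open>auto simp: \<phi>_def intro: modsmooth_nonneg modsmooth_mono\<close>)
    show "0 \<le> Lambda r m x (modsmooth (m - r) (D r) (x 0) (x m))"
      using L_nonneg unfolding \<phi>_def .
    show "\<bar>divdiff D (map x [0..<Suc m])\<bar>
        \<le> \<bar>4 ^ m * K4\<bar> * Lambda r m x (modsmooth (m - r) (D r) (x 0) (x m))"
      using dd_le mult_right_mono[OF abs_ge_self L_nonneg, of "4 ^ m * K4"] unfolding \<phi>_def by linarith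
  qed simp
qed

theorem theorem2p1:
  fixes m :: nat
  shows "\<exists>c>0. \<forall>(r::nat) (x::nat \<Rightarrow> real) (D::nat \<Rightarrow> real \<Rightarrow> real).
     r + 1 \<le> m \<longrightarrow>
     (\<forall>j<m. x j \<le> x (Suc j)) \<longrightarrow>
     (\<forall>j. j + r + 1 \<le> m \<longrightarrow> x j < x (j + r + 1)) \<longrightarrow>
     Cr_on r D (x 0) (x m) \<longrightarrow>
     \<bar>divdiff D (map x [0..<Suc m])\<bar>
       \<le> c * Lambda r m x (modsmooth (m - r) (D r) (x 0) (x m))"
proof -
  define good where "good r c \<longleftrightarrow> (\<forall>(x::nat \<Rightarrow> real) D.
     (\<forall>j<m. x j \<le> x (Suc j)) \<longrightarrow> (\<forall>j. j + r + 1 \<le> m \<longrightarrow> x j < x (j + r + 1)) \<longrightarrow>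
     Cr_on r D (x 0) (x m) \<longrightarrow> 0 \<le> Lambda r m x (modsmooth (m - r) (D r) (x 0) (x m)) \<and>
     \<bar>divdiff D (map x [0..<Suc m])\<bar> \<le> c * Lambda r m x (modsmooth (m - r) (D r) (x 0) (x m)))"
    for r c
  have "\<exists>c\<ge>0. good r c" if "r < m" for r
    using divided_difference_bound[OF that] unfolding good_def .
  then obtain c where c: "\<And>r. r < m \<Longrightarrow> 0 \<le> c r" "\<And>r. r < m \<Longrightarrow> good r (c r)"
    by metis
  show ?thesis
  \<comment> \<open>Only \<open>r < m\<close> occur, so the finite sum depends on \<open>m\<close>
    alone; the 1 ensures positivity.\<close>
  proof (intro exI[of _ "1 + (\<Sum>r<m. c r)"] conjI allI impI)
    show "0 < 1 + (\<Sum>r<m. c r)" using sum_nonneg[of "{..<m}" c] c(1) by auto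
    fix r and x :: "nat \<Rightarrow> real" and D
    assume *: "r + 1 \<le> m" "\<forall>j<m. x j \<le> x (Suc j)" "\<forall>j. j + r + 1 \<le> m \<longrightarrow> x j < x (j + r + 1)"
      "Cr_on r D (x 0) (x m)"
    define L where "L = Lambda r m x (modsmooth (m - r) (D r) (x 0) (x m))"
    have L: "0 \<le> L" "\<bar>divdiff D (map x [0..<Suc m])\<bar> \<le> c r * L"
      using c(2)[of r] * unfolding L_def good_def by auto
    have "c r \<le> (\<Sum>r<m. c r)" using * c(1) by (intro member_le_sum) auto
    then have "c r * L \<le> (1 + (\<Sum>r<m. c r)) * L" using L by (intro mult_right_mono) auto
    then show "\<bar>divdiff D (map x [0..<Suc m])\<bar>
        \<le> (1 + (\<Sum>r<m. c r)) * Lambda r m x (modsmooth (m - r) (D r) (x 0) (x m))"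
      using L unfolding L_def by linarith
  qed
qed

end
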